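(* Let $f(z)=\sum_{k=-n}^m c_k z^k$ be a Laurent polynomial with complex coefficients, $n,m\ge 1$, $c_{-n}\ne 0$, $c_m\neq 0$. Let $g\in\mathbb{C}[z,z^{-1}]$ be a Laurent polynomial such that $\int_{|z|=1} g'(w)\,dw=0$. Then $$\int_{|z|=1} f^k(w)g'(w)\,dw=0\quad\text{for every integer }k\ge 0$$ if and only if $\int_{C_f(t)} g\equiv 0$ for the cycle $$C_f(t)=\sum_{k=1}^n m\, z_{a_k}(t)-\sum_{k=n+1}^{n+m} n\, z_{b_k}(t)$$ of $f$, where, for $t$ close to infinity, $z_{a_k}(t)$ ($k=1,\dots,n$) are the solutions of $f(z)=t$ close to $0$ and $z_{b_k}(t)$ ($k=n+1,\dots,n+m$) are the solutions of $f(z)=t$ close to $\infty$.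
   Context: The Laurent polynomial $f$ is a rational function of degree $n+m$; for $t$ of large modulus the equation $f(z)=t$ has $n+m$ distinct solutions, $n$ of them close to $0$ and $m$ close to $\infty$, depending analytically on $t$ locally. A cycle of $f$ is a formal integer combination $C(t)=\sum_i n_i z_i(t)$ of these solutions with $\sum_i n_i=0$, and $\int_{C(t)} g:=\sum_i n_i g(z_i(t))$; "$\equiv 0$" means identically zero in $t$. The path $|z|=1$ is the positively oriented unit circle. *)

theory Defs
  imports "HOL-Complex_Analysis.Complex_Analysis" "HOL-Library.Poly_Mapping"
begin

text \<open>
  A Laurent polynomial over \<open>\<complex>\<close> is an element of the monoid algebra of the additive group
  \<open>int\<close>. Its evaluation is meaningful away from \<open>0\<close> only; at \<open>0\<close> it takes a junk value.
\<close>

definition laurent_eval :: "(int \<Rightarrow>\<^sub>0 complex) \<Rightarrow> complex \<Rightarrow> complex" where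
  "laurent_eval f z = (\<Sum>k\<in>Poly_Mapping.keys f. Poly_Mapping.lookup f k * z powi k)"

definition solutions :: "(int \<Rightarrow>\<^sub>0 complex) \<Rightarrow> complex \<Rightarrow> complex set" where
  "solutions f t = {w. w \<noteq> 0 \<and> laurent_eval f w = t}"

text \<open>
  Analytic branches \<open>z 1, \<dots>, z (n + m)\<close> of the solutions of \<open>f(w) = t\<close>, pairwise distinct and
  exhaustive, over a domain \<open>U\<close> that reaches infinity (for instance a half-plane or a slit
  neighbourhood of infinity; the branches are in general multivalued on a full punctured
  neighbourhood). The first \<open>n\<close> branches are those close to \<open>0\<close> and the remaining \<open>m\<close> those close
  to infinity when \<open>t\<close> is close to infinity.
\<close>

definition branches_at_infinity ::
    "(int \<Rightarrow>\<^sub>0 complex) \<Rightarrow> nat \<Rightarrow> nat \<Rightarrow> complex set \<Rightarrow> (nat \<Rightarrow> complex \<Rightarrow> complex) \<Rightarrow> bool" where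
  "branches_at_infinity f n m U z \<longleftrightarrow>
     open U \<and> connected U \<and> \<not> bounded U \<and>
     (\<forall>k\<in>{1..n+m}. z k holomorphic_on U) \<and>
     (\<forall>t\<in>U. bij_betw (\<lambda>k. z k t) {1..n+m} (solutions f t)) \<and>
     (\<forall>k\<in>{1..n}. (z k \<longlongrightarrow> 0) (inf at_infinity (principal U))) \<and>
     (\<forall>k\<in>{n+1..n+m}. filterlim (z k) at_infinity (inf at_infinity (principal U)))"

text \<open>
  A formal combination of \<open>N\<close> solutions is given by its coefficients with respect to the
  branches \<open>z 1, \<dots>, z N\<close>; it is a cycle if the coefficients sum to zero.
\<close>

definition is_cycle :: "nat \<Rightarrow> (nat \<Rightarrow> int) \<Rightarrow> bool" where
  "is_cycle N \<nu> \<longleftrightarrow> (\<Sum>k\<in>{1..N}. \<nu> k) = 0"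

definition cycle_integral ::
    "nat \<Rightarrow> (nat \<Rightarrow> int) \<Rightarrow> (nat \<Rightarrow> complex \<Rightarrow> complex) \<Rightarrow> (complex \<Rightarrow> complex) \<Rightarrow> complex \<Rightarrow> complex" where
  "cycle_integral N \<nu> z g t = (\<Sum>k\<in>{1..N}. of_int (\<nu> k) * g (z k t))"

definition cycle_at_infinity :: "nat \<Rightarrow> nat \<Rightarrow> nat \<Rightarrow> int" where
  "cycle_at_infinity n m k = (if k \<le> n then int m else - int n)"

lemma is_cycle_cycle_at_infinity: "is_cycle (n + m) (cycle_at_infinity n m)"
proof -
  have "{1..n+m} = {1..n} \<union> {n+1..n+m}" by auto
  then have "(\<Sum>k\<in>{1..n+m}. cycle_at_infinity n m k) =
      (\<Sum>k\<in>{1..n}. cycle_at_infinity n m k) + (\<Sum>k\<in>{n+1..n+m}. cycle_at_infinity n m k)"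
    by (simp only:) (rule sum.union_disjoint; auto)
  also have "\<dots> = (\<Sum>k\<in>{1..n}. int m) + (\<Sum>k\<in>{n+1..n+m}. - int n)"
    by (intro arg_cong2[of _ _ _ _ "(+)"] sum.cong) (auto simp: cycle_at_infinity_def)
  finally show ?thesis by (simp add: is_cycle_def)
qed

text \<open>
  Such branches always exist (over a half-plane): near \<open>0\<close>, \<open>f(w) = h(w) / w ^ n\<close> with \<open>h(0) \<noteq> 0\<close> is
  the \<open>n\<close>-th power of the inverse of a local coordinate, and likewise near infinity.
\<close>

lemma local_branches:
  fixes h :: "complex \<Rightarrow> complex"
  assumes "n \<ge> 1" and holh: "h holomorphic_on UNIV" and h0: "h 0 \<noteq> 0"
  obtains R \<zeta> where "R > 0"
    and "\<And>k. \<zeta> k holomorphic_on {t. Re t > R}"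
    and "\<And>k t. Re t > R \<Longrightarrow> \<zeta> k t \<noteq> 0 \<and> norm (\<zeta> k t) < 1 \<and> h (\<zeta> k t) = t * \<zeta> k t ^ n"
    and "\<And>t. Re t > R \<Longrightarrow> inj_on (\<lambda>k. \<zeta> k t) {..<n}"
    and "\<And>k. (\<zeta> k \<longlongrightarrow> 0) (inf at_infinity (principal {t. Re t > R}))"
proof -
  have "isCont h 0"
    using holomorphic_on_imp_continuous_on[OF holh]
    by (simp add: continuous_on_eq_continuous_at)
  then have "((\<lambda>z. h z / h 0) \<longlongrightarrow> h 0 / h 0) (nhds 0)"
    using h0 by (intro tendsto_intros) (auto simp: isCont_def tendsto_nhds_iff)
  then have "\<forall>\<^sub>F z in nhds 0. dist (h z / h 0) (h 0 / h 0) < 1"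
    by (rule tendstoD) simp
  then obtain d where d: "d > 0" "\<And>z. dist z 0 < d \<Longrightarrow> dist (h z / h 0) (h 0 / h 0) < 1"
    unfolding eventually_nhds_metric by blast
  define r where "r = min d 1"
  have r: "r > 0" "r \<le> 1" using d by (auto simp: r_def)
  have npos: "h z / h 0 \<notin> \<real>\<^sub>\<le>\<^sub>0" if "z \<in> ball 0 r" for z
  proof
    assume a: "h z / h 0 \<in> \<real>\<^sub>\<le>\<^sub>0"
    have "norm (h z / h 0 - 1) < 1"
      using d(2)[of z] that h0 by (simp add: r_def dist_norm)
    moreover have "\<bar>Re (h z / h 0 - 1)\<bar> \<le> norm (h z / h 0 - 1)" by (rule abs_Re_le_cmod)
    moreover have "Re (h z / h 0) \<le> 0" using a by (auto simp: complex_nonpos_Reals_iff)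
    ultimately show False by simp
  qed
  define a where "a = exp (- Ln (h 0) / of_nat n)"
  define p where "p z = a * exp (- Ln (h z / h 0) / of_nat n)" for z
  define \<phi> where "\<phi> z = z * p z" for z
  have holp: "p holomorphic_on ball 0 r"
    unfolding p_def using npos h0 assms(1)
    by (intro holomorphic_intros holomorphic_on_subset[OF holh]) auto
  have hol\<phi>: "\<phi> holomorphic_on ball 0 r"
    unfolding \<phi>_def by (intro holomorphic_intros holp)
  have pn: "p z ^ n * h z = 1" if "z \<in> ball 0 r" for z
  proof -
    have hz: "h z \<noteq> 0" using npos[OF that] by auto
    have "a ^ n = exp (- Ln (h 0))"
      unfolding a_def using assms(1) by (simp flip: exp_of_nat_mult)
    moreover have "exp (- Ln (h z / h 0) / of_nat n) ^ n = exp (- Ln (h z / h 0))"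
      using assms(1) by (simp flip: exp_of_nat_mult)
    ultimately have "p z ^ n = inverse (h 0) * inverse (h z / h 0)"
      using h0 hz by (simp add: p_def power_mult_distrib exp_minus)
    then show ?thesis using h0 hz by (simp add: field_simps)
  qed
  have "p 0 \<noteq> 0" by (simp add: p_def a_def)
  have "(p has_field_derivative deriv p 0) (at 0)"
    using holomorphic_derivI[OF holp] r by simp
  then have "(\<phi> has_field_derivative (1 * p 0 + deriv p 0 * 0)) (at 0)"
    unfolding \<phi>_def by (intro DERIV_mult) (auto intro: derivative_eq_intros)
  then have d\<phi>: "deriv \<phi> 0 \<noteq> 0" using \<open>p 0 \<noteq> 0\<close> by (simp add: DERIV_imp_deriv)
  have r0: "0 \<in> ball (0::complex) r" using r by simp
  obtain s where s: "s > 0" "ball (0::complex) s \<subseteq> ball 0 r" "open (\<phi> ` ball 0 s)" "inj_on \<phi> (ball 0 s)"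
    by (rule has_complex_derivative_locally_invertible[OF hol\<phi> r0 open_ball d\<phi>])
  obtain G where G: "G holomorphic_on \<phi> ` ball 0 s" "\<And>z. z \<in> ball 0 s \<Longrightarrow> G (\<phi> z) = z"
    using holomorphic_has_inverse[OF holomorphic_on_subset[OF hol\<phi> s(2)] open_ball s(4)] by metis
  have \<phi>0: "\<phi> 0 = 0" by (simp add: \<phi>_def)
  have "0 \<in> \<phi> ` ball 0 s" using s(1) \<phi>0 by (metis centre_in_ball imageI)
  then obtain e where e: "e > 0" "ball 0 e \<subseteq> \<phi> ` ball 0 s"
    using s(3) open_contains_ball by blast
  have G0: "G 0 = 0" using G(2)[of 0] s(1) \<phi>0 by simp
  have GB: "G y \<in> ball 0 s \<and> \<phi> (G y) = y" if "y \<in> ball 0 e" for y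
    using that e(2) G(2) by force
  define R where "R = max 1 (exp (- of_nat n * ln e))"
  define \<eta> where "\<eta> k t = cis (2 * pi * real k / real n) * exp (- Ln t / of_nat n)" for k :: nat and t
  define \<zeta> where "\<zeta> k t = G (\<eta> k t)" for k t
  have R: "R > 0" by (simp add: R_def)
  have tn: "norm t > R \<and> t \<noteq> 0 \<and> t \<notin> \<real>\<^sub>\<le>\<^sub>0" if "Re t > R" for t
    using that R complex_Re_le_cmod[of t] by (auto simp: complex_nonpos_Reals_iff)
  have n\<eta>: "norm (\<eta> k t) = exp (- ln (norm t) / real n)" if "Re t > R" for k t
    using tn[OF that] assms(1) by (simp add: \<eta>_def norm_mult)
  have \<eta>e: "\<eta> k t \<in> ball 0 e" if "Re t > R" for k t
  proof -
    have "ln (norm t) > ln (exp (- of_nat n * ln e))"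
      using tn[OF that] by (subst ln_less_cancel_iff) (auto simp: R_def)
    then have "- ln (norm t) / real n < ln e"
      using assms(1) by (simp add: field_simps)
    then have "exp (- ln (norm t) / real n) < exp (ln e)" by simp
    then show ?thesis using e n\<eta>[OF that, of k] by simp
  qed
  have \<eta>n: "\<eta> k t ^ n * t = 1" if "Re t > R" for k t
  proof -
    have "cis (2 * pi * real k / real n) ^ n = 1"
    proof -
      have "real n * (2 * pi * real k / real n) = 2 * pi * real k"
        using assms(1) by simp
      then show ?thesis by (simp only: Complex.DeMoivre) (simp add: cis_multiple_2pi)
    qed
    moreover have "exp (- Ln t / of_nat n) ^ n = inverse t"
      using assms(1) tn[OF that] by (simp flip: exp_of_nat_mult) (simp add: exp_minus)
    ultimately show ?thesis using tn[OF that] by (simp add: \<eta>_def power_mult_distrib)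
  qed
  show ?thesis
  proof
    show "R > 0" by (rule R)
    show "\<zeta> k holomorphic_on {t. Re t > R}" for k
    proof -
      have "\<eta> k holomorphic_on {t. Re t > R}"
        unfolding \<eta>_def using tn assms(1) by (intro holomorphic_intros) auto
      moreover have "G holomorphic_on ball 0 e" by (rule holomorphic_on_subset[OF G(1) e(2)])
      ultimately have "(G \<circ> \<eta> k) holomorphic_on {t. Re t > R}"
        by (rule holomorphic_on_compose_gen) (use \<eta>e in auto)
      then show ?thesis by (simp add: \<zeta>_def[abs_def] o_def)
    qed
    show "\<zeta> k t \<noteq> 0 \<and> norm (\<zeta> k t) < 1 \<and> h (\<zeta> k t) = t * \<zeta> k t ^ n" if t: "Re t > R" for k t
    proof -
      have z: "\<zeta> k t \<in> ball 0 s" "\<phi> (\<zeta> k t) = \<eta> k t"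
        using GB[OF \<eta>e[OF t]] by (auto simp: \<zeta>_def)
      have zr: "\<zeta> k t \<in> ball 0 r" using z s by auto
      have "\<eta> k t \<noteq> 0" by (simp add: \<eta>_def)
      then have "\<zeta> k t \<noteq> 0" using z \<phi>0 by auto
      moreover have "norm (\<zeta> k t) < 1" using zr r by simp
      moreover have "\<zeta> k t ^ n * p (\<zeta> k t) ^ n * t = 1"
        using \<eta>n[OF t, of k] by (simp add: \<phi>_def power_mult_distrib flip: z(2))
      then have "h (\<zeta> k t) * (\<zeta> k t ^ n * p (\<zeta> k t) ^ n * t) = h (\<zeta> k t)" by simp
      then have "(p (\<zeta> k t) ^ n * h (\<zeta> k t)) * (\<zeta> k t ^ n * t) = h (\<zeta> k t)"
        by (simp only: mult_ac)
      then have "h (\<zeta> k t) = t * \<zeta> k t ^ n" unfolding pn[OF zr] by (simp add: mult.commute)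
      ultimately show ?thesis by blast
    qed
    show "inj_on (\<lambda>k. \<zeta> k t) {..<n}" if t: "Re t > R" for t
    proof (rule inj_onI)
      fix i j assume ij: "i \<in> {..<n}" "j \<in> {..<n}" "\<zeta> i t = \<zeta> j t"
      then have "\<eta> i t = \<eta> j t" using GB[OF \<eta>e[OF t]] by (metis \<zeta>_def)
      then have "cis (2 * pi * real i / real n) = cis (2 * pi * real j / real n)"
        by (simp add: \<eta>_def)
      moreover have "inj_on (\<lambda>k. cis (2 * pi * real k / real n)) {..<n}"
        using Complex.bij_betw_roots_unity[of n] assms(1) by (auto simp: bij_betw_def)
      ultimately show "i = j" using ij by (auto dest: inj_onD)
    qed
    show "(\<zeta> k \<longlongrightarrow> 0) (inf at_infinity (principal {t. Re t > R}))" for k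
    proof -
      let ?F = "inf at_infinity (principal {t::complex. Re t > R})"
      have ev: "\<forall>\<^sub>F t in ?F. Re t > R" by (simp add: eventually_inf_principal)
      have nt: "filterlim norm at_top ?F"
        by (rule filterlim_mono[OF filterlim_norm_at_top]) auto
      have "((\<lambda>x::real. exp (- ln x / real n)) \<longlongrightarrow> 0) at_top"
      proof -
        have "filterlim (\<lambda>x::real. (1 / real n) * ln x) at_top at_top"
          using assms(1) by (intro filterlim_tendsto_pos_mult_at_top[OF tendsto_const _ ln_at_top]) auto
        then have "filterlim (\<lambda>x::real. - ((1 / real n) * ln x)) at_bot at_top"
          by (simp add: filterlim_uminus_at_bot)
        from filterlim_compose[OF exp_at_bot this] show ?thesis by simp
      qed
      from filterlim_compose[OF this nt]
      have "((\<lambda>t. norm (\<eta> k t)) \<longlongrightarrow> 0) ?F"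
        by (rule Lim_transform_eventually) (use ev in eventually_elim, simp add: n\<eta>)
      then have "(\<eta> k \<longlongrightarrow> 0) ?F" by (simp add: tendsto_norm_zero_iff)
      moreover have "isCont G 0"
      proof -
        have "G holomorphic_on ball 0 e" by (rule holomorphic_on_subset[OF G(1) e(2)])
        then show ?thesis
          using e(1) by (meson centre_in_ball continuous_on_interior holomorphic_on_imp_continuous_on
              interior_open open_ball continuous_on_eq_continuous_at)
      qed
      ultimately have "((\<lambda>t. G (\<eta> k t)) \<longlongrightarrow> G 0) ?F" by (rule isCont_tendsto_compose[rotated])
      then show ?thesis by (simp add: \<zeta>_def[abs_def] G0)
    qed
  qed
qed

lemma branches_at_infinity_exist:
  fixes f :: "int \<Rightarrow>\<^sub>0 complex"
  assumes n: "n \<ge> 1" and m: "m \<ge> 1"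
    and keys: "Poly_Mapping.keys f \<subseteq> {- int n..int m}"
    and cn: "Poly_Mapping.lookup f (- int n) \<noteq> 0" and cm: "Poly_Mapping.lookup f (int m) \<noteq> 0"
  shows "\<exists>U z. branches_at_infinity f n m U z"
proof -
  define c where "c j = Poly_Mapping.lookup f (int j - int n)" for j
  have ev: "laurent_eval f w = (\<Sum>j\<le>n+m. c j * w powi (int j - int n))" for w
  proof -
    have "laurent_eval f w = (\<Sum>k\<in>{- int n..int m}. Poly_Mapping.lookup f k * w powi k)"
      unfolding laurent_eval_def using keys by (intro sum.mono_neutral_left) (auto simp: in_keys_iff)
    also have "\<dots> = (\<Sum>j\<le>n+m. c j * w powi (int j - int n))"
      unfolding c_def
      by (rule sum.reindex_bij_witness[of _ "\<lambda>j. int j - int n" "\<lambda>k. nat (k + int n)"]) auto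
    finally show ?thesis .
  qed
  define h where "h w = (\<Sum>j\<le>n+m. c j * w ^ j)" for w
  define h' where "h' w = (\<Sum>j\<le>n+m. c j * w ^ (n + m - j))" for w
  have h: "h w = laurent_eval f w * w ^ n" if "w \<noteq> 0" for w
    unfolding ev h_def sum_distrib_right
    by (intro sum.cong refl) (use that in \<open>auto simp: power_int_diff\<close>)
  have h': "h' w = laurent_eval f (inverse w) * w ^ m" if "w \<noteq> 0" for w
    unfolding ev h'_def sum_distrib_right
  proof (intro sum.cong refl)
    fix j assume "j \<in> {..n+m}"
    then have "w ^ (n + m - j) = w ^ n * w ^ m / w ^ j"
      using that by (simp add: power_diff power_add)
    then show "c j * w ^ (n + m - j) = c j * inverse w powi (int j - int n) * w ^ m"
      using that by (simp add: power_int_diff field_simps)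
  qed
  have "h holomorphic_on UNIV" "h' holomorphic_on UNIV"
    unfolding h_def h'_def by (intro holomorphic_intros)+
  moreover have "h 0 = c 0"
    unfolding h_def by (subst sum.remove[of _ 0]) (auto intro!: sum.neutral)
  moreover have "h' 0 = c (n + m)"
    unfolding h'_def by (subst sum.remove[of _ "n + m"]) (auto intro!: sum.neutral)
  moreover have "c 0 \<noteq> 0" "c (n + m) \<noteq> 0" using cn cm by (auto simp: c_def)
  ultimately have H: "h holomorphic_on UNIV" "h 0 \<noteq> 0" "h' holomorphic_on UNIV" "h' 0 \<noteq> 0" by auto
  obtain R1 \<zeta>1 where A: "R1 > 0" "\<And>k. \<zeta>1 k holomorphic_on {t. Re t > R1}"
    "\<And>k t. Re t > R1 \<Longrightarrow> \<zeta>1 k t \<noteq> 0 \<and> norm (\<zeta>1 k t) < 1 \<and> h (\<zeta>1 k t) = t * \<zeta>1 k t ^ n"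
    "\<And>t. Re t > R1 \<Longrightarrow> inj_on (\<lambda>k. \<zeta>1 k t) {..<n}"
    "\<And>k. (\<zeta>1 k \<longlongrightarrow> 0) (inf at_infinity (principal {t. Re t > R1}))"
    using local_branches[OF n H(1,2)] by metis
  obtain R2 \<zeta>2 where B: "R2 > 0" "\<And>k. \<zeta>2 k holomorphic_on {t. Re t > R2}"
    "\<And>k t. Re t > R2 \<Longrightarrow> \<zeta>2 k t \<noteq> 0 \<and> norm (\<zeta>2 k t) < 1 \<and> h' (\<zeta>2 k t) = t * \<zeta>2 k t ^ m"
    "\<And>t. Re t > R2 \<Longrightarrow> inj_on (\<lambda>k. \<zeta>2 k t) {..<m}"
    "\<And>k. (\<zeta>2 k \<longlongrightarrow> 0) (inf at_infinity (principal {t. Re t > R2}))"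
    using local_branches[OF m H(3,4)] by metis
  define U where "U = {t. Re t > max R1 R2}"
  define z where "z k = (if k \<le> n then \<zeta>1 (k - 1) else (\<lambda>t. inverse (\<zeta>2 (k - n - 1) t)))" for k
  have "U \<subseteq> {t. Re t > R1}" "U \<subseteq> {t. Re t > R2}" by (auto simp: U_def)
  then have F: "inf at_infinity (principal U) \<le> inf at_infinity (principal {t. Re t > R1})"
     "inf at_infinity (principal U) \<le> inf at_infinity (principal {t. Re t > R2})"
    by (intro inf_mono order_refl; simp)+
  have "open U" unfolding U_def by (rule open_halfspace_Re_gt)
  moreover have "connected U"
    unfolding U_def by (rule convex_connected[OF convex_halfspace_Re_gt])
  moreover have "\<not> bounded U"
  proof
    assume "bounded U"
    then obtain C where C: "\<And>x. x \<in> U \<Longrightarrow> norm x \<le> C" by (auto simp: bounded_iff)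
    define x where "x = \<bar>C\<bar> + R1 + R2 + 1"
    have "complex_of_real x \<in> U" using A(1) B(1) abs_ge_zero[of C] by (simp add: U_def x_def del: of_real_add abs_ge_zero)
    from C[OF this] show False using A(1) B(1) by (simp add: x_def del: of_real_add)
  qed
  moreover have "z k holomorphic_on U" for k
  proof -
    have "\<zeta>1 k holomorphic_on U" "\<zeta>2 k holomorphic_on U" for k
      using A(2) B(2) by (auto simp: U_def intro: holomorphic_on_subset)
    then show ?thesis
      unfolding z_def using B(3) by (auto intro!: holomorphic_intros simp: U_def)
  qed
  moreover have "(z k \<longlongrightarrow> 0) (inf at_infinity (principal U))" if "k \<in> {1..n}" for k
    using that tendsto_mono[OF F(1) A(5)] by (simp add: z_def)
  moreover have "filterlim (z k) at_infinity (inf at_infinity (principal U))"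
    if "k \<in> {n+1..n+m}" for k
  proof -
    have "filterlim (\<zeta>2 (k - n - 1)) (at 0) (inf at_infinity (principal U))"
      using tendsto_mono[OF F(2) B(5)] B(3)
      by (auto simp: filterlim_at eventually_inf_principal U_def)
    from filterlim_compose[OF filterlim_inverse_at_infinity this] show ?thesis
      using that by (simp add: z_def)
  qed
  moreover have "bij_betw (\<lambda>k. z k t) {1..n+m} (solutions f t)" if "t \<in> U" for t
  proof -
    have t: "Re t > R1" "Re t > R2" using that by (auto simp: U_def)
    have small: "norm (z k t) < 1" if "k \<le> n" for k
      using that A(3)[OF t(1)] by (auto simp: z_def)
    have big: "norm (z k t) > 1" if "\<not> k \<le> n" for k
      using that B(3)[OF t(2), of "k - n - 1"]
      by (auto simp: z_def norm_inverse one_less_inverse)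
    have inj: "inj_on (\<lambda>k. z k t) {1..n+m}"
    proof (rule inj_onI)
      fix i j assume ij: "i \<in> {1..n+m}" "j \<in> {1..n+m}" "z i t = z j t"
      consider "i \<le> n" "j \<le> n" | "\<not> i \<le> n" "\<not> j \<le> n" | "i \<le> n \<longleftrightarrow> \<not> j \<le> n" by blast
      then show "i = j"
      proof cases
        case 1
        then have "\<zeta>1 (i - 1) t = \<zeta>1 (j - 1) t" using ij by (simp add: z_def)
        then have "i - 1 = j - 1"
          using ij 1 by (intro inj_onD[OF A(4)[OF t(1)]]) auto
        then show ?thesis using ij by auto
      next
        case 2
        then have "\<zeta>2 (i - n - 1) t = \<zeta>2 (j - n - 1) t" using ij by (simp add: z_def)
        then have "i - n - 1 = j - n - 1"
          using ij 2 by (intro inj_onD[OF B(4)[OF t(2)]]) auto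
        then show ?thesis using ij 2 by auto
      next
        case 3
        then show ?thesis using small[of i] small[of j] big[of i] big[of j] ij by auto
      qed
    qed
    have sub: "(\<lambda>k. z k t) ` {1..n+m} \<subseteq> solutions f t"
    proof safe
      fix k assume "k \<in> {1..n+m}"
      show "z k t \<in> solutions f t"
      proof (cases "k \<le> n")
        case True
        have q: "\<zeta>1 (k - 1) t \<noteq> 0" "h (\<zeta>1 (k - 1) t) = t * \<zeta>1 (k - 1) t ^ n"
          using A(3)[OF t(1)] by auto
        then show ?thesis using True h[OF q(1)] by (simp add: solutions_def z_def)
      next
        case False
        have q: "\<zeta>2 (k - n - 1) t \<noteq> 0" "h' (\<zeta>2 (k - n - 1) t) = t * \<zeta>2 (k - n - 1) t ^ m"
          using B(3)[OF t(2)] by auto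
        then show ?thesis using False h'[OF q(1)] by (simp add: solutions_def z_def)
      qed
    qed
    define P where "P = (\<Sum>j\<le>n+m. monom (c j) j) - monom t n"
    have cP: "coeff P (n + m) = c (n + m)"
      using m by (simp add: P_def coeff_sum if_distrib sum.delta cong: if_cong)
    have dP: "degree P \<le> n + m"
      unfolding P_def
      by (intro degree_diff_le degree_sum_le) (auto intro: order.trans[OF degree_monom_le])
    have "P \<noteq> 0" using cP \<open>c (n + m) \<noteq> 0\<close> by auto
    have sol: "solutions f t \<subseteq> {x. poly P x = 0}"
    proof
      fix x assume "x \<in> solutions f t"
      then have "x \<noteq> 0" "laurent_eval f x = t" by (auto simp: solutions_def)
      then show "x \<in> {x. poly P x = 0}"
        using h[of x] by (simp add: P_def poly_sum poly_monom h_def)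
    qed
    have "card (solutions f t) \<le> n + m"
      using card_mono[OF poly_roots_finite[OF \<open>P \<noteq> 0\<close>] sol] card_poly_roots_bound[OF \<open>P \<noteq> 0\<close>] dP
      by linarith
    then have "(\<lambda>k. z k t) ` {1..n+m} = solutions f t"
      using sub card_image[OF inj] finite_subset[OF sol poly_roots_finite[OF \<open>P \<noteq> 0\<close>]]
      by (intro card_seteq) auto
    then show ?thesis using inj by (simp add: bij_betw_def)
  qed
  ultimately show ?thesis unfolding branches_at_infinity_def by blast
qed

end

theory Submission
  imports Defs "HOL-Computational_Algebra.Fundamental_Theorem_Algebra"
begin

text \<open>
  Write \<open>S\<^sub>0(t)\<close> and \<open>S\<^sub>\<infinity>(t)\<close> for the sums of \<open>g\<close> over the solutions of \<open>f = t\<close> close to \<open>0\<close> and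
  close to infinity, so that the integral of \<open>g\<close> over the cycle is \<open>m S\<^sub>0 - n S\<^sub>\<infinity>\<close>. Everything is
  compared with the Cauchy-type integral over the unit circle
  \<open>J(t) = \<integral> g f' / (f - t)\<close>.

  For large \<open>t\<close> the small solutions are the ones inside the circle. By the residue theorem
  \<open>J = 2 \<pi> i S\<^sub>0 + p\<^sub>0\<close>, where the contribution \<open>p\<^sub>0\<close> of the pole at \<open>0\<close> is a polynomial in \<open>t\<close>
  (\<open>circle_integral_eq_small_fibre_sum\<close>). The substitution \<open>w \<mapsto> 1 / w\<close> exchanges \<open>0\<close> and infinity,
  turns \<open>J\<close> into \<open>- J\<close> (\<open>contour_integral_unit_circle_inverse\<close>), and therefore gives
  \<open>- J = 2 \<pi> i S\<^sub>\<infinity> + p\<^sub>1\<close> with another polynomial \<open>p\<^sub>1\<close>.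

  On the other hand, expanding \<open>1 / (f - t)\<close> in powers of \<open>1 / t\<close> shows that the coefficients of \<open>J\<close> at
  infinity are, up to sign, the moments \<open>\<integral> g f' f^k\<close>, and integration by parts makes them multiples
  of \<open>\<integral> f^(k+1) g'\<close> (\<open>circle_integral_by_parts\<close>). So the vanishing of all \<open>\<integral> f^k g'\<close> with \<open>k \<ge> 1\<close> means that
  \<open>J\<close> vanishes near infinity.

  If \<open>m S\<^sub>0 = n S\<^sub>\<infinity>\<close>, the two formulas above show that \<open>J\<close> is a polynomial. Since \<open>J\<close> tends to \<open>0\<close> at
  infinity it vanishes there, and so do its coefficients
  (\<open>polynomial_resolvent_imp_circle_moments_zero\<close>).

  Conversely, if \<open>J = 0\<close>, then \<open>S\<^sub>0\<close> agrees near infinity with a polynomial in \<open>t\<close>. The monodromy group of \<open>f\<close> acts transitively on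
  the solutions of \<open>f = t\<close>, because the plane without \<open>0\<close> and the critical fibres, in which they live, is
  connected. Averaging the single-valued function \<open>S\<^sub>0\<close> over this group gives
  \<open>(n + m) S\<^sub>0 = n (S\<^sub>0 + S\<^sub>\<infinity>)\<close>, that is \<open>m S\<^sub>0 = n S\<^sub>\<infinity>\<close>. The lemma
  \<open>partial_fibre_sum_eq_average\<close> carries out this averaging without analytic continuation along paths:
  instead of the orbit of a set of solutions it uses all sets of \<open>n\<close> solutions with the same sum, and
  counts how many of them contain a given point.
\<close>

section \<open>Laurent polynomials as quotients by powers\<close>

lemma laurent_eval_eq_poly_divide_power:
  assumes keys: "Poly_Mapping.keys f \<subseteq> {- int n..int m}"
  obtains h where "degree h \<le> n + m"
    and "\<And>j. j \<le> n + m \<Longrightarrow> coeff h j = Poly_Mapping.lookup f (int j - int n)"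
    and "\<And>w. w \<noteq> 0 \<Longrightarrow> laurent_eval f w = poly h w / w ^ n"
proof -
  define c where "c j = Poly_Mapping.lookup f (int j - int n)" for j
  define h where "h = (\<Sum>j\<le>n+m. monom (c j) j)"
  show ?thesis
  proof (rule that[of h])
    show "degree h \<le> n + m"
      unfolding h_def by (intro degree_sum_le) (auto intro: order.trans[OF degree_monom_le])
    show "coeff h j = Poly_Mapping.lookup f (int j - int n)" if "j \<le> n + m" for j
      using that by (simp add: h_def coeff_sum if_distrib sum.delta c_def cong: if_cong)
    fix w :: complex assume w: "w \<noteq> 0"
    have "laurent_eval f w = (\<Sum>k\<in>{- int n..int m}. Poly_Mapping.lookup f k * w powi k)"
      unfolding laurent_eval_def using keys by (intro sum.mono_neutral_left) (auto simp: in_keys_iff)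
    also have "\<dots> = (\<Sum>j\<le>n+m. c j * w powi (int j - int n))"
      unfolding c_def
      by (rule sum.reindex_bij_witness[of _ "\<lambda>j. int j - int n" "\<lambda>k. nat (k + int n)"]) auto
    also have "\<dots> = poly h w / w ^ n"
      using w by (simp add: h_def poly_sum poly_monom sum_divide_distrib power_int_diff)
    finally show "laurent_eval f w = poly h w / w ^ n" .
  qed
qed

lemma laurent_eval_eq_poly_divide_some_power:
  obtains G L where "\<And>w. w \<noteq> 0 \<Longrightarrow> laurent_eval g w = poly G w / w ^ L"
proof -
  obtain K where K: "abs ` Poly_Mapping.keys g \<subseteq> {..K}"
    using finite_int_iff_bounded_le finite_keys by blast
  have "Poly_Mapping.keys g \<subseteq> {- int (nat K)..int (nat K)}"
  proof
    fix k assume "k \<in> Poly_Mapping.keys g"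
    then have "\<bar>k\<bar> \<le> K" using K by auto
    then show "k \<in> {- int (nat K)..int (nat K)}" by auto
  qed
  then show ?thesis by (rule laurent_eval_eq_poly_divide_power) (rule that)
qed

text \<open>
  Reversing the coefficients of the numerator corresponds to the substitution \<open>w \<mapsto> 1 / w\<close>; the orders
  of the poles at \<open>0\<close> and at infinity are exchanged.
\<close>

lemma poly_divide_power_inverse:
  fixes h :: "complex poly"
  assumes "degree h = n + m" "w \<noteq> 0"
  shows "poly h (inverse w) / inverse w ^ n = poly (reflect_poly h) w / w ^ m"
  using assms by (simp add: poly_reflect_poly_nz power_add field_simps)

lemma has_field_derivative_poly_divide_power:
  fixes h :: "complex poly"
  assumes f: "\<And>w. w \<noteq> 0 \<Longrightarrow> f w = poly h w / w ^ n" and w: "w \<noteq> 0"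
  shows "(f has_field_derivative
      (w * poly (pderiv h) w - of_nat n * poly h w) / w ^ Suc n) (at w)"
proof -
  have "((\<lambda>w. poly h w / w ^ n) has_field_derivative
      (poly (pderiv h) w * w ^ n - poly h w * (of_nat n * w ^ (n - 1))) / (w ^ n * w ^ n)) (at w)"
    using w by (auto intro!: derivative_eq_intros poly_DERIV)
  moreover have "(poly (pderiv h) w * w ^ n - poly h w * (of_nat n * w ^ (n - 1))) / (w ^ n * w ^ n)
      = (w * poly (pderiv h) w - of_nat n * poly h w) / w ^ Suc n"
    using w by (cases n) (auto simp: field_simps)
  ultimately have "((\<lambda>w. poly h w / w ^ n) has_field_derivative
      (w * poly (pderiv h) w - of_nat n * poly h w) / w ^ Suc n) (at w)" by simp
  then show ?thesis
    by (rule has_field_derivative_transform_within_open[where S = "-{0}"]) (use w f in auto)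
qed

text \<open>
  The numerator of \<open>f'\<close> is \<open>w h'(w) - n h(w)\<close>, which does not vanish at \<open>0\<close>.
\<close>

lemma finite_critical_points:
  fixes h :: "complex poly"
  assumes f: "\<And>w. w \<noteq> 0 \<Longrightarrow> f w = poly h w / w ^ n" and n: "n \<ge> 1" and h0: "poly h 0 \<noteq> 0"
  shows "finite {w. w \<noteq> 0 \<and> deriv f w = 0}"
proof -
  define E where "E = pCons 0 (pderiv h) - smult (of_nat n) h"
  have "poly E 0 \<noteq> 0" using n h0 by (simp add: E_def)
  then have "finite {w. poly E w = 0}" by (intro poly_roots_finite) auto
  moreover have "{w. w \<noteq> 0 \<and> deriv f w = 0} \<subseteq> {w. poly E w = 0}"
    using DERIV_imp_deriv[OF has_field_derivative_poly_divide_power[OF f]] by (auto simp: E_def)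
  ultimately show ?thesis by (rule rev_finite_subset)
qed

text \<open>
  The solutions of \<open>f = t\<close> are the roots of the polynomial \<open>h(w) - t w^n\<close>. It has degree \<open>n + m\<close> and does
  not vanish at \<open>0\<close> because \<open>n\<close> lies strictly between \<open>0\<close> and \<open>n + m\<close>. A multiple root would be a critical
  point of \<open>f\<close>.
\<close>

lemma fibre_finite_card:
  fixes h :: "complex poly"
  assumes f: "\<And>w. w \<noteq> 0 \<Longrightarrow> f w = poly h w / w ^ n" and deg: "degree h = n + m"
    and n: "n \<ge> 1" and m: "m \<ge> 1" and h0: "poly h 0 \<noteq> 0"
  shows "finite {w. w \<noteq> 0 \<and> f w = t}" and "card {w. w \<noteq> 0 \<and> f w = t} \<le> n + m"
    and "(\<And>w. w \<noteq> 0 \<Longrightarrow> f w = t \<Longrightarrow> deriv f w \<noteq> 0) \<Longrightarrow> card {w. w \<noteq> 0 \<and> f w = t} = n + m"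
proof -
  define P where "P = h - monom t n"
  have P0: "poly P 0 \<noteq> 0" using h0 n by (simp add: P_def poly_monom power_0_left)
  then have Pn0: "P \<noteq> 0" by auto
  have degP: "degree P = n + m"
    unfolding P_def using deg m degree_monom_le[of t n]
    by (subst diff_conv_add_uminus, subst degree_add_eq_left) auto
  have fibre: "{w. w \<noteq> 0 \<and> f w = t} = {w. poly P w = 0}"
  proof (intro Collect_cong)
    show "w \<noteq> 0 \<and> f w = t \<longleftrightarrow> poly P w = 0" for w
      using P0 f[of w] by (cases "w = 0") (auto simp: P_def poly_monom field_simps)
  qed
  show "finite {w. w \<noteq> 0 \<and> f w = t}" unfolding fibre using Pn0 by (rule poly_roots_finite)
  show "card {w. w \<noteq> 0 \<and> f w = t} \<le> n + m"
    unfolding fibre using card_poly_roots_bound[OF Pn0] degP by simp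
  assume simple: "\<And>w. w \<noteq> 0 \<Longrightarrow> f w = t \<Longrightarrow> deriv f w \<noteq> 0"
  have "rsquarefree P"
    unfolding rsquarefree_roots
  proof (intro allI notI)
    fix a assume a: "poly P a = 0 \<and> poly (pderiv P) a = 0"
    then have a0: "a \<noteq> 0" "f a = t" using fibre by auto
    have wn: "a * a ^ (n - 1) = a ^ n" using n by (cases n) auto
    have "poly h a = t * a ^ n" "poly (pderiv h) a = t * (of_nat n * a ^ (n - 1))"
      using a by (auto simp: P_def pderiv_diff pderiv_monom poly_monom)
    then have "a * poly (pderiv h) a - of_nat n * poly h a = 0"
      using wn by (simp add: algebra_simps)
    then have "deriv f a = 0"
      using DERIV_imp_deriv[OF has_field_derivative_poly_divide_power[OF f a0(1)]] by simp
    with simple a0 show False by blast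
  qed
  then have "P = smult (lead_coeff P) (\<Prod>z|poly P z = 0. [:-z, 1:])"
    by (rule complex_poly_decompose_rsquarefree[symmetric])
  then have "degree P = degree (smult (lead_coeff P) (\<Prod>z|poly P z = 0. [:-z, 1:]))" by simp
  also have "\<dots> = card {z. poly P z = 0}"
    using Pn0 by (subst degree_smult_eq, simp, subst degree_prod_eq_sum_degree) auto
  finally show "card {w. w \<noteq> 0 \<and> f w = t} = n + m"
    by (simp add: fibre degP)
qed

section \<open>Cauchy-type integrals over the unit circle\<close>

lemma continuous_on_unit_circle_bounded:
  fixes u :: "complex \<Rightarrow> complex"
  assumes "continuous_on (sphere 0 1) u"
  obtains B where "B \<ge> 0" "\<And>w. norm w = 1 \<Longrightarrow> norm (u w) \<le> B"
proof -
  obtain B where B: "\<forall>x\<in>u ` sphere 0 1. norm x \<le> B"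
    using compact_imp_bounded[OF compact_continuous_image[OF assms compact_sphere]]
    unfolding bounded_iff by blast
  show ?thesis
  proof (rule that[of "max B 0"])
    show "norm (u w) \<le> max B 0" if "norm w = 1" for w
      using B that by (force simp: le_max_iff_disj)
  qed simp
qed

text \<open>
  Inversion maps the unit circle to itself and reverses its orientation; this sign cancels the one of
  the derivative \<open>- 1 / w^2\<close> of the inversion.
\<close>

lemma contour_integral_unit_circle_inverse:
  "contour_integral (circlepath 0 1) (\<lambda>w. u (inverse w) / w ^ 2) = contour_integral (circlepath 0 1) u"
proof -
  have rev: "reversepath (circlepath 0 1) = (\<lambda>x. exp (- (2 * of_real pi * \<i> * of_real x)))"
  proof
    fix x :: real
    have "2 * of_real pi * \<i> * of_real (1 - x) = 2 * of_real pi * \<i> + - (2 * of_real pi * \<i> * of_real x)"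
      by (simp add: algebra_simps)
    then have "exp (2 * of_real pi * \<i> * of_real (1 - x)) = exp (2 * of_real pi * \<i>) * exp (- (2 * of_real pi * \<i> * of_real x))"
      by (simp only: exp_add)
    then show "reversepath (circlepath 0 1) x = exp (- (2 * of_real pi * \<i> * of_real x))"
      by (simp add: reversepath_def circlepath)
  qed
  have vd: "vector_derivative (reversepath (circlepath 0 1)) (at x) =
      - (2 * of_real pi * \<i>) * exp (- (2 * of_real pi * \<i> * of_real x))" for x
    unfolding rev
    by (rule vector_derivative_at, rule has_vector_derivative_real_field)
      (auto intro!: derivative_eq_intros)
  have pointwise: "u (inverse (circlepath 0 1 x)) / circlepath 0 1 x ^ 2 *
        vector_derivative (circlepath 0 1) (at x) =
      - (u (reversepath (circlepath 0 1) x) * vector_derivative (reversepath (circlepath 0 1)) (at x))" for x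
  proof -
    define e where "e = exp (2 * of_real pi * \<i> * of_real x)"
    have "e \<noteq> 0" by (simp add: e_def)
    moreover have "circlepath 0 1 x = e" by (simp add: circlepath e_def)
    moreover have "reversepath (circlepath 0 1) x = inverse e" by (simp add: rev exp_minus e_def)
    moreover have "vector_derivative (circlepath 0 1) (at x) = 2 * of_real pi * \<i> * e"
      by (simp add: vector_derivative_circlepath e_def)
    moreover have "vector_derivative (reversepath (circlepath 0 1)) (at x) = - (2 * of_real pi * \<i>) * inverse e"
      by (simp add: vd exp_minus e_def)
    ultimately show ?thesis by (simp add: power2_eq_square divide_inverse mult_ac)
  qed
  have "contour_integral (circlepath 0 1) (\<lambda>w. u (inverse w) / w ^ 2)
      = - contour_integral (reversepath (circlepath 0 1)) u"
    unfolding contour_integral_integral integral_neg[symmetric] pointwise ..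
  then show ?thesis by (simp add: contour_integral_reversepath)
qed

text \<open>
  The two integrands add up to the derivative of \<open>g f^(k+1)\<close>.
\<close>

lemma circle_integral_by_parts:
  assumes f: "f holomorphic_on - {0}" and g: "g holomorphic_on - {0}"
  shows "of_nat (Suc k) * contour_integral (circlepath 0 1) (\<lambda>w. g w * deriv f w * f w ^ k) =
      - contour_integral (circlepath 0 1) (\<lambda>w. f w ^ Suc k * deriv g w)"
proof -
  have open0: "open (- {0::complex})" by auto
  have cont: "continuous_on (sphere 0 1) f" "continuous_on (sphere 0 1) g"
    "continuous_on (sphere 0 1) (deriv f)" "continuous_on (sphere 0 1) (deriv g)"
    using f g holomorphic_deriv[OF f open0] holomorphic_deriv[OF g open0]
    by (auto intro!: holomorphic_on_imp_continuous_on elim!: holomorphic_on_subset)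
  have "((\<lambda>w. g w * f w ^ Suc k) has_field_derivative
      f w ^ Suc k * deriv g w + of_nat (Suc k) * (g w * deriv f w * f w ^ k)) (at w within - {0})"
    if "w \<in> - {0}" for w
  proof -
    have "(f has_field_derivative deriv f w) (at w)" "(g has_field_derivative deriv g w) (at w)"
      using holomorphic_derivI[OF f open0 that] holomorphic_derivI[OF g open0 that] by auto
    from DERIV_mult[OF this(2) DERIV_power[OF this(1), of "Suc k"]]
    have "((\<lambda>w. g w * f w ^ Suc k) has_field_derivative
        f w ^ Suc k * deriv g w + of_nat (Suc k) * (g w * deriv f w * f w ^ k)) (at w)"
      by (rule DERIV_cong) (simp add: algebra_simps)
    then show ?thesis by (rule has_field_derivative_at_within)
  qed
  from contour_integral_primitive[OF this, of "circlepath 0 1"]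
  have "((\<lambda>w. f w ^ Suc k * deriv g w + of_nat (Suc k) * (g w * deriv f w * f w ^ k))
      has_contour_integral 0) (circlepath 0 1)" by auto
  moreover have "((\<lambda>w. f w ^ Suc k * deriv g w + of_nat (Suc k) * (g w * deriv f w * f w ^ k))
      has_contour_integral (contour_integral (circlepath 0 1) (\<lambda>w. f w ^ Suc k * deriv g w) +
        of_nat (Suc k) * contour_integral (circlepath 0 1) (\<lambda>w. g w * deriv f w * f w ^ k)))
      (circlepath 0 1)"
    by (intro has_contour_integral_add has_contour_integral_lmul has_contour_integral_integral
        contour_integrable_continuous_circlepath) (use cont in \<open>auto intro!: continuous_intros\<close>)
  ultimately have "contour_integral (circlepath 0 1) (\<lambda>w. f w ^ Suc k * deriv g w) +
        of_nat (Suc k) * contour_integral (circlepath 0 1) (\<lambda>w. g w * deriv f w * f w ^ k) = 0"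
    by (blast dest: has_contour_integral_unique)
  then show ?thesis by (simp only: add_eq_0_iff)
qed

lemma tendsto_0_circle_integral_resolvent:
  fixes u \<phi> :: "complex \<Rightarrow> complex"
  assumes u: "continuous_on (sphere 0 1) u" and \<phi>: "continuous_on (sphere 0 1) \<phi>"
  shows "((\<lambda>t. contour_integral (circlepath 0 1) (\<lambda>w. u w / (\<phi> w - t))) \<longlongrightarrow> 0) at_infinity"
proof -
  obtain B where B: "B \<ge> 0" "\<And>w. norm w = 1 \<Longrightarrow> norm (u w) \<le> B"
    using continuous_on_unit_circle_bounded[OF u] by blast
  obtain M where M: "M \<ge> 0" "\<And>w. norm w = 1 \<Longrightarrow> norm (\<phi> w) \<le> M"
    using continuous_on_unit_circle_bounded[OF \<phi>] by blast
  note B0 = B(1)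
  have bound: "norm (contour_integral (circlepath 0 1) (\<lambda>w. u w / (\<phi> w - t)))
      \<le> 2 * pi * B * inverse (norm t - M)" if t: "norm t > M" for t
  proof -
    have ne: "\<phi> w \<noteq> t" if "norm w = 1" for w using M(2)[OF that] t by auto
    have "(\<lambda>w. u w / (\<phi> w - t)) contour_integrable_on circlepath 0 1"
      by (rule contour_integrable_continuous_circlepath)
        (use u \<phi> ne in \<open>auto intro!: continuous_intros\<close>)
    then have "norm (contour_integral (circlepath 0 1) (\<lambda>w. u w / (\<phi> w - t)))
        \<le> B / (norm t - M) * (2 * pi * 1)"
    proof (intro has_contour_integral_bound_circlepath[OF has_contour_integral_integral])
      fix w :: complex assume "norm (w - 0) = 1"
      then have w: "norm w = 1" by simp
      have "norm (\<phi> w - t) \<ge> norm t - M"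
        using M(2)[OF w] norm_triangle_ineq2[of t "\<phi> w"] by (simp add: norm_minus_commute)
      then show "norm (u w / (\<phi> w - t)) \<le> B / (norm t - M)"
        using B(2)[OF w] t B0 by (simp add: norm_divide frac_le)
    qed (use B0 t in auto)
    then show ?thesis by (simp add: field_simps)
  qed
  have "filterlim (\<lambda>t::complex. norm t - M) at_top at_infinity"
    unfolding filterlim_at_top eventually_at_infinity
  proof
    fix Z show "\<exists>b. \<forall>t::complex. b \<le> norm t \<longrightarrow> Z \<le> norm t - M"
      by (rule exI[of _ "Z + M"]) auto
  qed
  then have "((\<lambda>t::complex. inverse (norm t - M)) \<longlongrightarrow> 0) at_infinity"
    by (rule tendsto_inverse_0_at_top)
  then have "((\<lambda>t::complex. 2 * pi * B * inverse (norm t - M)) \<longlongrightarrow> 0) at_infinity"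
    by (rule tendsto_mult_right_zero)
  moreover have "\<forall>\<^sub>F t in at_infinity. norm (contour_integral (circlepath 0 1) (\<lambda>w. u w / (\<phi> w - t)))
      \<le> 2 * pi * B * inverse (norm t - M)"
    unfolding eventually_at_infinity
    by (rule exI[of _ "M + 1"]) (use bound in force)
  ultimately show ?thesis by (rule Lim_null_comparison[rotated])
qed

text \<open>
  The finite geometric sum \<open>(\<phi>^K - t^K) / (\<phi> - t)\<close>, integrated against \<open>u\<close>. Keeping the remainder
  explicit yields the Laurent coefficients of the integral at \<open>t = \<infinity>\<close> one after the other, also along
  an approach to infinity within an arbitrary unbounded set.
\<close>

lemma circle_integral_resolvent_expansion:
  fixes u \<phi> :: "complex \<Rightarrow> complex"
  assumes u: "continuous_on (sphere 0 1) u" and \<phi>: "continuous_on (sphere 0 1) \<phi>"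
    and t: "t \<noteq> 0" "\<And>w. norm w = 1 \<Longrightarrow> \<phi> w \<noteq> t"
  shows "t ^ K * contour_integral (circlepath 0 1) (\<lambda>w. u w / (\<phi> w - t)) =
      contour_integral (circlepath 0 1) (\<lambda>w. u w * \<phi> w ^ K / (\<phi> w - t))
      - (\<Sum>k<K. t ^ (K - Suc k) * contour_integral (circlepath 0 1) (\<lambda>w. u w * \<phi> w ^ k))"
proof -
  have ci: "(\<lambda>w. u w * \<phi> w ^ K / (\<phi> w - t)) contour_integrable_on circlepath 0 1"
     "(\<lambda>w. u w * \<phi> w ^ k) contour_integrable_on circlepath 0 1" for k
    using assms by (auto intro!: contour_integrable_continuous_circlepath continuous_intros)
  have ci0: "(\<lambda>w. u w / (\<phi> w - t)) contour_integrable_on circlepath 0 1"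
    using assms by (auto intro!: contour_integrable_continuous_circlepath continuous_intros)
  have alg: "u w * \<phi> w ^ K / (\<phi> w - t) - (\<Sum>k<K. t ^ (K - Suc k) * (u w * \<phi> w ^ k))
      = t ^ K * (u w / (\<phi> w - t))" if "norm w = 1" for w
  proof -
    have "(\<Sum>k<K. t ^ (K - Suc k) * (u w * \<phi> w ^ k)) * (\<phi> w - t) = u w * (\<phi> w ^ K - t ^ K)"
      unfolding power_diff_sumr2[of "\<phi> w"] by (simp add: sum_distrib_left sum_distrib_right mult_ac)
    then show ?thesis using t(2)[OF that] by (simp add: field_simps)
  qed
  have "((\<lambda>w. t ^ K * (u w / (\<phi> w - t))) has_contour_integral
      (contour_integral (circlepath 0 1) (\<lambda>w. u w * \<phi> w ^ K / (\<phi> w - t))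
      - (\<Sum>k<K. t ^ (K - Suc k) * contour_integral (circlepath 0 1) (\<lambda>w. u w * \<phi> w ^ k))))
      (circlepath 0 1)"
    by (rule has_contour_integral_eq[OF has_contour_integral_diff[OF has_contour_integral_integral[OF ci(1)]
          has_contour_integral_sum[OF finite_lessThan has_contour_integral_lmul[OF has_contour_integral_integral[OF ci(2)]]]]])
      (use alg in auto)
  moreover have "((\<lambda>w. t ^ K * (u w / (\<phi> w - t))) has_contour_integral
      t ^ K * contour_integral (circlepath 0 1) (\<lambda>w. u w / (\<phi> w - t))) (circlepath 0 1)"
    by (rule has_contour_integral_lmul[OF has_contour_integral_integral[OF ci0]])
  ultimately show ?thesis by (blast dest: has_contour_integral_unique)
qed

text \<open>
  When all moments vanish only the remainder of the expansion is left, and it is at most a constant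
  times \<open>(M / norm t) ^ K\<close> for every \<open>K\<close>.
\<close>

lemma circle_moments_zero_imp_resolvent_zero:
  fixes u \<phi> :: "complex \<Rightarrow> complex"
  assumes u: "continuous_on (sphere 0 1) u" and \<phi>: "continuous_on (sphere 0 1) \<phi>"
    and M: "\<And>w. norm w = 1 \<Longrightarrow> norm (\<phi> w) \<le> M" and t: "norm t > M"
    and zero: "\<And>k. contour_integral (circlepath 0 1) (\<lambda>w. u w * \<phi> w ^ k) = 0"
  shows "contour_integral (circlepath 0 1) (\<lambda>w. u w / (\<phi> w - t)) = 0"
proof -
  define J where "J = contour_integral (circlepath 0 1) (\<lambda>w. u w / (\<phi> w - t))"
  have M0: "M \<ge> 0"
    using order_trans[OF norm_ge_zero M[of 1]] by simp
  have t0: "t \<noteq> 0" using M0 t by auto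
  have ne: "\<phi> w \<noteq> t" if "norm w = 1" for w using M[OF that] t by auto
  have cont: "continuous_on (sphere 0 1) (\<lambda>w. u w / (\<phi> w - t))"
    using u \<phi> ne by (auto intro!: continuous_intros)
  obtain B where B: "B \<ge> 0" "\<And>w. norm w = 1 \<Longrightarrow> norm (u w / (\<phi> w - t)) \<le> B"
    using continuous_on_unit_circle_bounded[OF cont] by blast
  note B0 = B(1)
  have "norm J \<le> 2 * pi * B * (M / norm t) ^ K" for K
  proof -
    have "t ^ K * J = contour_integral (circlepath 0 1) (\<lambda>w. u w * \<phi> w ^ K / (\<phi> w - t))"
      using circle_integral_resolvent_expansion[OF u \<phi> t0 ne, of K] zero by (simp add: J_def)
    moreover have "norm (contour_integral (circlepath 0 1) (\<lambda>w. u w * \<phi> w ^ K / (\<phi> w - t)))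
        \<le> B * M ^ K * (2 * pi * 1)"
    proof (intro has_contour_integral_bound_circlepath[OF has_contour_integral_integral])
      show "(\<lambda>w. u w * \<phi> w ^ K / (\<phi> w - t)) contour_integrable_on circlepath 0 1"
        using u \<phi> ne by (auto intro!: contour_integrable_continuous_circlepath continuous_intros)
      fix w :: complex assume "norm (w - 0) = 1"
      then have "norm (u w / (\<phi> w - t)) * norm (\<phi> w) ^ K \<le> B * M ^ K"
        using B(2)[of w] M[of w] M0 B0 by (intro mult_mono power_mono) auto
      then show "norm (u w * \<phi> w ^ K / (\<phi> w - t)) \<le> B * M ^ K"
        by (simp add: norm_mult norm_divide norm_power)
    qed (use B0 M0 in auto)
    ultimately have "norm (t ^ K * J) \<le> B * M ^ K * (2 * pi * 1)" by (simp only:)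
    then have "norm t ^ K * norm J \<le> 2 * pi * B * M ^ K"
      by (simp add: norm_mult norm_power mult_ac)
    then show ?thesis using t0 by (simp add: power_divide field_simps)
  qed
  moreover have "(\<lambda>K. 2 * pi * B * (M / norm t) ^ K) \<longlonglongrightarrow> 2 * pi * B * 0"
    using M0 t t0 by (intro tendsto_intros LIMSEQ_power_zero) (auto simp: divide_less_eq)
  ultimately have "norm J \<le> 2 * pi * B * 0"
    by (intro LIMSEQ_le_const[of _ _ "norm J"]) auto
  then show ?thesis by (simp add: J_def)
qed

text \<open>
  The integral tends to \<open>0\<close> at infinity, so the polynomial \<open>q\<close> must be \<open>0\<close>. Once the integral is \<open>0\<close> and the
  moments below \<open>k\<close> vanish, the expansion of order \<open>k + 1\<close> says that the \<open>k\<close>-th moment equals a remainder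
  which tends to \<open>0\<close> as well.
\<close>

lemma polynomial_resolvent_imp_circle_moments_zero:
  fixes u \<phi> :: "complex \<Rightarrow> complex"
  assumes u: "continuous_on (sphere 0 1) u" and \<phi>: "continuous_on (sphere 0 1) \<phi>"
    and F: "F \<le> at_infinity" "F \<noteq> bot"
    and q: "\<forall>\<^sub>F t in F. contour_integral (circlepath 0 1) (\<lambda>w. u w / (\<phi> w - t)) = poly q t"
  shows "contour_integral (circlepath 0 1) (\<lambda>w. u w * \<phi> w ^ k) = 0"
proof -
  define J where "J t = contour_integral (circlepath 0 1) (\<lambda>w. u w / (\<phi> w - t))" for t
  have "(J \<longlongrightarrow> 0) F"
    unfolding J_def by (rule tendsto_mono[OF F(1) tendsto_0_circle_integral_resolvent[OF u \<phi>]])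
  then have q0: "(poly q \<longlongrightarrow> 0) F"
    by (rule Lim_transform_eventually) (use q in \<open>simp add: J_def\<close>)
  have "q = 0"
  proof (cases "degree q")
    case 0
    then obtain a where a: "q = [:a:]" by (rule degree_eq_zeroE)
    then have "poly q = (\<lambda>_. a)" by auto
    then have "((\<lambda>_. a) \<longlongrightarrow> 0) F" using q0 by (simp only:)
    then show ?thesis using a F(2) by (simp add: tendsto_const_iff)
  next
    case (Suc d)
    then have "filterlim (poly q) at_infinity F"
      by (intro filterlim_mono[OF filterlim_poly_at_infinity order_refl F(1)]) auto
    then show ?thesis using q0 F(2) not_tendsto_and_filterlim_at_infinity by blast
  qed
  then have J0: "\<forall>\<^sub>F t in F. J t = 0" using q by (simp add: J_def)
  obtain M where M: "M \<ge> 0" "\<And>w. norm w = 1 \<Longrightarrow> norm (\<phi> w) \<le> M"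
    using continuous_on_unit_circle_bounded[OF \<phi>] by blast
  have "\<forall>\<^sub>F t::complex in at_infinity. norm t \<ge> max 1 (M + 1)"
    unfolding eventually_at_infinity by blast
  then have large: "\<forall>\<^sub>F t in F. norm t \<ge> max 1 (M + 1)"
    using F(1) by (rule filter_leD[rotated])
  show ?thesis
  proof (induction k rule: less_induct)
    case (less k)
    have "\<forall>\<^sub>F t in F. contour_integral (circlepath 0 1) (\<lambda>w. u w * \<phi> w ^ Suc k / (\<phi> w - t)) =
        contour_integral (circlepath 0 1) (\<lambda>w. u w * \<phi> w ^ k)"
      using J0 large
    proof eventually_elim
      case (elim t)
      have t: "t \<noteq> 0" "\<And>w. norm w = 1 \<Longrightarrow> \<phi> w \<noteq> t"
        using elim(2) M by (force, smt (verit))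
      show ?case
        using circle_integral_resolvent_expansion[OF u \<phi> t, of "Suc k"] elim(1) less
        by (simp add: J_def)
    qed
    moreover have "((\<lambda>t. contour_integral (circlepath 0 1) (\<lambda>w. u w * \<phi> w ^ Suc k / (\<phi> w - t))) \<longlongrightarrow> 0) F"
      by (rule tendsto_mono[OF F(1) tendsto_0_circle_integral_resolvent])
        (use u \<phi> in \<open>auto intro!: continuous_intros\<close>)
    ultimately have "((\<lambda>t. contour_integral (circlepath 0 1) (\<lambda>w. u w * \<phi> w ^ k)) \<longlongrightarrow> 0) F"
      by (rule Lim_transform_eventually[rotated])
    then show ?case using F(2) by (simp add: tendsto_const_iff)
  qed
qed

section \<open>Sums over the solutions inside the unit circle\<close>

lemma circle_integral_polynomial_in_parameter:
  fixes q a b :: "complex \<Rightarrow> complex"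
  assumes q: "continuous_on (sphere 0 1) q" and a: "continuous_on (sphere 0 1) a"
    and b: "continuous_on (sphere 0 1) b"
  shows "\<exists>p. \<forall>t. contour_integral (circlepath 0 1) (\<lambda>w. q w * (\<Sum>i\<le>L. (t * a w + b w) ^ i)) = poly p t"
proof -
  define I where "I i j = contour_integral (circlepath 0 1)
      (\<lambda>w. q w * (of_nat (i choose j) * a w ^ j * b w ^ (i - j)))" for i j
  define p where "p = (\<Sum>i\<le>L. \<Sum>j\<le>i. monom (I i j) j)"
  have ci: "(\<lambda>w. q w * (of_nat (i choose j) * a w ^ j * b w ^ (i - j)))
      contour_integrable_on circlepath 0 1" for i j
    by (rule contour_integrable_continuous_circlepath) (use assms in \<open>auto intro!: continuous_intros\<close>)
  have "contour_integral (circlepath 0 1) (\<lambda>w. q w * (\<Sum>i\<le>L. (t * a w + b w) ^ i)) = poly p t" for t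
  proof -
    have "(\<lambda>w. q w * (\<Sum>i\<le>L. (t * a w + b w) ^ i)) = (\<lambda>w. \<Sum>i\<le>L. \<Sum>j\<le>i.
        t ^ j * (q w * (of_nat (i choose j) * a w ^ j * b w ^ (i - j))))"
      by (simp add: binomial_ring sum_distrib_left power_mult_distrib mult_ac)
    moreover have "((\<lambda>w. \<Sum>i\<le>L. \<Sum>j\<le>i.
        t ^ j * (q w * (of_nat (i choose j) * a w ^ j * b w ^ (i - j))))
        has_contour_integral (\<Sum>i\<le>L. \<Sum>j\<le>i. t ^ j * I i j)) (circlepath 0 1)"
      unfolding I_def by (intro has_contour_integral_sum has_contour_integral_lmul
          has_contour_integral_integral ci) auto
    ultimately show ?thesis
      by (simp add: contour_integral_unique p_def poly_sum poly_monom mult.commute)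
  qed
  then show ?thesis by blast
qed

text \<open>
  Put \<open>F = h - t w^n\<close> and \<open>E = w h' - n h\<close>, so that the integrand is \<open>G E / (w^(L+1) F)\<close>. Writing
  \<open>F = c (1 - w r)\<close> with \<open>c = h(0)\<close>, the first \<open>L + 1\<close> terms of the geometric series for \<open>1 / F\<close> contain the
  whole pole at \<open>0\<close>; they are polynomials in \<open>t\<close>, and so is their integral. The remaining term is
  \<open>G r^(L+1) E / F\<close>, where \<open>E / F = w F' / F - n\<close> is essentially a logarithmic derivative. The argument
  principle evaluates its integral: at a root of \<open>F\<close> one has \<open>w r = 1\<close>, and the residue is
  \<open>G / w^L = g\<close>.
\<close>

lemma circle_integral_eq_small_fibre_sum:
  fixes h G :: "complex poly" and f g :: "complex \<Rightarrow> complex"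
  assumes f: "\<And>w. w \<noteq> 0 \<Longrightarrow> f w = poly h w / w ^ n"
    and g: "\<And>w. w \<noteq> 0 \<Longrightarrow> g w = poly G w / w ^ L"
    and n: "n \<ge> 1" and h0: "poly h 0 \<noteq> 0"
  shows "\<exists>p. \<forall>t. (\<forall>w. norm w = 1 \<longrightarrow> f w \<noteq> t) \<longrightarrow>
      (\<forall>w. w \<noteq> 0 \<and> norm w < 1 \<and> f w = t \<longrightarrow> deriv f w \<noteq> 0) \<longrightarrow>
      contour_integral (circlepath 0 1) (\<lambda>w. g w * deriv f w / (f w - t)) =
        2 * of_real pi * \<i> * (\<Sum>w\<in>{w. w \<noteq> 0 \<and> norm w < 1 \<and> f w = t}. g w) + poly p t"
proof -
  define c where "c = poly h 0"
  have c: "c \<noteq> 0" using h0 by (simp add: c_def)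
  obtain h1 where h1: "\<And>w. poly h w = c + w * poly h1 w"
    by (cases h) (auto simp: c_def)
  define E where "E w = w * poly (pderiv h) w - of_nat n * poly h w" for w
  define q where "q w = poly G w * E w / (c * w ^ Suc L)" for w
  have df: "deriv f w = E w / w ^ Suc n" if "w \<noteq> 0" for w
    using has_field_derivative_poly_divide_power[OF f that] by (simp add: DERIV_imp_deriv E_def)
  have "continuous_on (sphere 0 1) q"
    unfolding q_def E_def using c by (auto intro!: continuous_intros)
  moreover have "continuous_on (sphere 0 1) (\<lambda>w. w ^ n / c)"
    "continuous_on (sphere 0 1) (\<lambda>w. - (w * poly h1 w) / c)"
    using c by (auto intro!: continuous_intros)
  ultimately have "\<exists>p. \<forall>t. contour_integral (circlepath 0 1)
      (\<lambda>w. q w * (\<Sum>i\<le>L. (t * (w ^ n / c) + - (w * poly h1 w) / c) ^ i)) = poly p t"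
    by (rule circle_integral_polynomial_in_parameter)
  then obtain p where p: "\<And>t. contour_integral (circlepath 0 1)
      (\<lambda>w. q w * (\<Sum>i\<le>L. (t * (w ^ n / c) + - (w * poly h1 w) / c) ^ i)) = poly p t"
    by blast
  show ?thesis
  proof (intro exI[of _ p] allI impI)
    fix t
    assume circ: "\<forall>w. norm w = 1 \<longrightarrow> f w \<noteq> t"
      and simple: "\<forall>w. w \<noteq> 0 \<and> norm w < 1 \<and> f w = t \<longrightarrow> deriv f w \<noteq> 0"
    define F where "F w = poly h w - t * w ^ n" for w
    define r where "r w = (t * w ^ (n - 1) - poly h1 w) / c" for w
    define H where "H w = poly G w * r w ^ Suc L" for w
    have wn: "w * w ^ (n - 1) = w ^ n" for w :: complex using n by (cases n) auto
    have wr: "w * r w = t * (w ^ n / c) + - (w * poly h1 w) / c" for w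
      using wn[of w] c by (simp add: r_def field_simps)
    have Fr: "F w = c * (1 - w * r w)" for w
      using c by (simp add: wr F_def h1 field_simps)
    have F0: "F 0 \<noteq> 0" using c by (simp add: Fr)
    have Ff: "F w = w ^ n * (f w - t)" if "w \<noteq> 0" for w
      using that f by (simp add: F_def field_simps)
    have dF: "(F has_field_derivative poly (pderiv h) w - t * (of_nat n * w ^ (n - 1))) (at w)" for w
      unfolding F_def by (auto intro!: derivative_eq_intros poly_DERIV)
    have EF: "E w = w * deriv F w - of_nat n * F w" for w
      unfolding DERIV_imp_deriv[OF dF] using wn[of w] by (simp add: E_def F_def algebra_simps)
    have holF: "F holomorphic_on UNIV" unfolding F_def by (intro holomorphic_intros)
    have holr: "r holomorphic_on UNIV" unfolding r_def using c by (intro holomorphic_intros) auto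
    have holH: "H holomorphic_on UNIV" unfolding H_def by (intro holomorphic_intros holr)
    have F1: "F w \<noteq> 0" if "norm w = 1" for w
      using circ that Ff[of w] by fastforce
    define Z where "Z = {w. F w = 0}"
    have Z: "Z = {w. w \<noteq> 0 \<and> f w = t}" unfolding Z_def
    proof (intro Collect_cong)
      show "F w = 0 \<longleftrightarrow> w \<noteq> 0 \<and> f w = t" for w
        using F0 Ff[of w] by (cases "w = 0") auto
    qed
    have "finite Z"
    proof -
      have Zp: "Z = {w. poly (h - monom t n) w = 0}" by (simp add: Z_def F_def poly_monom)
      have "h - monom t n \<noteq> 0" using F0 Zp by (auto simp: Z_def)
      then show ?thesis unfolding Zp by (rule poly_roots_finite)
    qed
    \<comment> \<open>\<open>1 / (1 - x) = (\<Sum>i\<le>L. x^i) + x^(L+1) / (1 - x)\<close> for \<open>x = w r\<close>; the factor \<open>w^(L+1)\<close> of the last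
      term cancels the pole at \<open>0\<close>.\<close>
    have split: "g w * deriv f w / (f w - t) =
        q w * (\<Sum>i\<le>L. (w * r w) ^ i) + (deriv F w * (w * H w) / F w - of_nat n * H w)"
      if "norm w = 1" for w
    proof -
      have w: "w \<noteq> 0" using that by auto
      have Fw: "F w \<noteq> 0" using F1 that by auto
      have "g w * deriv f w / (f w - t) = poly G w * E w / (w ^ Suc L * F w)"
      proof -
        have "f w - t = F w / w ^ n" using w Ff[OF w] by simp
        then show ?thesis using w by (simp add: g df)
      qed
      also have "\<dots> = q w * ((1 - w * r w) * (\<Sum>i\<le>L. (w * r w) ^ i) + (w * r w) ^ Suc L) / (1 - w * r w)"
        using sum_gp_basic[of "w * r w" L] Fw w c by (simp add: q_def Fr field_simps)
      also have "\<dots> = q w * (\<Sum>i\<le>L. (w * r w) ^ i) + q w * (w * r w) ^ Suc L / (1 - w * r w)"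
        using Fw c by (simp add: Fr field_simps)
      also have "q w * (w * r w) ^ Suc L / (1 - w * r w) = H w * E w / F w"
        using Fw c w unfolding q_def H_def Fr power_mult_distrib by (simp add: field_simps)
      also have "\<dots> = deriv F w * (w * H w) / F w - of_nat n * H w"
        using Fw by (simp add: EF field_simps)
      finally show ?thesis .
    qed
    have I1: "((\<lambda>w. q w * (\<Sum>i\<le>L. (w * r w) ^ i)) has_contour_integral poly p t) (circlepath 0 1)"
    proof -
      have "(\<lambda>w. q w * (\<Sum>i\<le>L. (w * r w) ^ i)) contour_integrable_on circlepath 0 1"
      proof (rule contour_integrable_continuous_circlepath)
        have "continuous_on (sphere 0 1) r"
          using holr holomorphic_on_imp_continuous_on continuous_on_subset by blast
        then show "continuous_on (path_image (circlepath 0 1)) (\<lambda>w. q w * (\<Sum>i\<le>L. (w * r w) ^ i))"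
          using \<open>continuous_on (sphere 0 1) q\<close> by (auto intro!: continuous_intros)
      qed
      then show ?thesis using p[of t] has_contour_integral_integral by (fastforce simp: wr)
    qed
    have I2: "((\<lambda>w. of_nat n * H w) has_contour_integral 0) (circlepath 0 1)"
      by (rule Cauchy_theorem_disc_simple[where a = 0 and e = 2])
        (auto intro!: holomorphic_intros holomorphic_on_subset[OF holH])
    have ord: "zorder F w = 1" if "w \<in> Z" "norm w < 1" for w
    proof -
      have w: "w \<noteq> 0" "f w = t" "F w = 0" using that Z by (auto simp: Z_def)
      have "deriv f w \<noteq> 0" using simple w that(2) by blast
      then have "E w \<noteq> 0" using df[OF w(1)] by auto
      then have "deriv F w \<noteq> 0" using w EF[of w] by auto
      then show ?thesis
        using w by (intro zorder_zero_eqI[OF holF open_UNIV UNIV_I]) auto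
    qed
    have "contour_integral (circlepath 0 1) (\<lambda>w. deriv F w * (w * H w) / F w) =
        2 * pi * \<i> * (\<Sum>w\<in>{w \<in> UNIV. F w = 0 \<or> w \<in> {}}.
          winding_number (circlepath 0 1) w * (w * H w) * zorder F w)"
      by (rule argument_principle)
        (use holF holH F1 \<open>finite Z\<close> in \<open>auto simp: Z_def intro!: holomorphic_intros\<close>)
    also have "(\<Sum>w\<in>{w \<in> UNIV. F w = 0 \<or> w \<in> {}}.
          winding_number (circlepath 0 1) w * (w * H w) * zorder F w) =
        (\<Sum>w\<in>{w. w \<noteq> 0 \<and> norm w < 1 \<and> f w = t}. g w)"
    proof -
      have "(\<Sum>w\<in>Z. winding_number (circlepath 0 1) w * (w * H w) * zorder F w) =
          (\<Sum>w\<in>{w. w \<noteq> 0 \<and> norm w < 1 \<and> f w = t}. g w)"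
      proof (rule sum.mono_neutral_cong_right)
        show "finite Z" by fact
        show "{w. w \<noteq> 0 \<and> norm w < 1 \<and> f w = t} \<subseteq> Z" by (auto simp: Z)
        show "\<forall>w\<in>Z - {w. w \<noteq> 0 \<and> norm w < 1 \<and> f w = t}.
            winding_number (circlepath 0 1) w * (w * H w) * zorder F w = 0"
        proof
          fix w assume "w \<in> Z - {w. w \<noteq> 0 \<and> norm w < 1 \<and> f w = t}"
          then have "norm w > 1" using F1[of w] Z by (force simp: Z_def not_less le_less)
          then have "winding_number (circlepath 0 1) w = 0"
            by (intro winding_number_zero_outside[of _ "cball 0 1"]) auto
          then show "winding_number (circlepath 0 1) w * (w * H w) * zorder F w = 0" by simp
        qed
        fix w assume "w \<in> {w. w \<noteq> 0 \<and> norm w < 1 \<and> f w = t}"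
        then have w: "w \<noteq> 0" "norm w < 1" "w \<in> Z" by (auto simp: Z)
        have "winding_number (circlepath 0 1) w = 1"
          using w by (intro winding_number_circlepath) auto
        moreover have "w * r w = 1" using w(3) c by (simp add: Z_def Fr)
        then have "r w = 1 / w" using w(1) by (simp add: field_simps)
        then have "w * H w = g w" using w(1) by (simp add: H_def g divide_inverse power_inverse)
        ultimately show "winding_number (circlepath 0 1) w * (w * H w) * zorder F w = g w"
          using ord[OF w(3,2)] by simp
      qed
      then show ?thesis by (simp add: Z_def)
    qed
    finally have "contour_integral (circlepath 0 1) (\<lambda>w. deriv F w * (w * H w) / F w) =
        2 * pi * \<i> * (\<Sum>w\<in>{w. w \<noteq> 0 \<and> norm w < 1 \<and> f w = t}. g w)" .
    moreover have "(\<lambda>w. deriv F w * (w * H w) / F w) contour_integrable_on circlepath 0 1"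
    proof (rule contour_integrable_continuous_circlepath)
      have "continuous_on (sphere 0 1) F" "continuous_on (sphere 0 1) H" "continuous_on (sphere 0 1) (deriv F)"
        using holF holH holomorphic_deriv[OF holF] holomorphic_on_imp_continuous_on continuous_on_subset
        by blast+
      then show "continuous_on (path_image (circlepath 0 1)) (\<lambda>w. deriv F w * (w * H w) / F w)"
        using F1 by (auto intro!: continuous_intros)
    qed
    ultimately have I3: "((\<lambda>w. deriv F w * (w * H w) / F w) has_contour_integral
        2 * pi * \<i> * (\<Sum>w\<in>{w. w \<noteq> 0 \<and> norm w < 1 \<and> f w = t}. g w)) (circlepath 0 1)"
      by (metis has_contour_integral_integral)
    have "((\<lambda>w. g w * deriv f w / (f w - t)) has_contour_integral
        poly p t + (2 * pi * \<i> * (\<Sum>w\<in>{w. w \<noteq> 0 \<and> norm w < 1 \<and> f w = t}. g w) - 0)) (circlepath 0 1)"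
      by (rule has_contour_integral_eq[OF has_contour_integral_add[OF I1 has_contour_integral_diff[OF I3 I2]]])
        (use split in auto)
    then show "contour_integral (circlepath 0 1) (\<lambda>w. g w * deriv f w / (f w - t)) =
        2 * of_real pi * \<i> * (\<Sum>w\<in>{w. w \<noteq> 0 \<and> norm w < 1 \<and> f w = t}. g w) + poly p t"
      by (simp add: contour_integral_unique)
  qed
qed

section \<open>Averaging over the fibres of a connected covering\<close>

text \<open>
  Double counting: every point of \<open>S\<close> lies in the same number of members of the family, so summing \<open>g\<close>
  and the constant \<open>1\<close> over all members yields the same multiple of the sum of \<open>g\<close> over \<open>S\<close> and of the
  cardinality of \<open>S\<close>.
\<close>

lemma sum_over_regular_set_family:
  fixes g :: "'a \<Rightarrow> complex"
  assumes "finite S" and \<O>: "\<And>B. B \<in> \<O> \<Longrightarrow> B \<subseteq> S \<and> card B = k \<and> sum g B = r" "\<O> \<noteq> {}"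
    and c: "\<And>z. z \<in> S \<Longrightarrow> card {B \<in> \<O>. z \<in> B} = c"
  shows "of_nat (card S) * r = of_nat k * sum g S"
proof -
  have "finite \<O>" using \<O>(1) \<open>finite S\<close> by (intro finite_subset[of \<O> "Pow S"]) auto
  have count: "(\<Sum>B\<in>\<O>. sum \<psi> B) = of_nat c * sum \<psi> S" for \<psi> :: "'a \<Rightarrow> complex"
  proof -
    have "(\<Sum>B\<in>\<O>. sum \<psi> B) = (\<Sum>B\<in>\<O>. \<Sum>z | z \<in> S \<and> z \<in> B. \<psi> z)"
      by (intro sum.cong refl) (use \<O>(1) in auto)
    also have "\<dots> = (\<Sum>z\<in>S. \<Sum>B | B \<in> \<O> \<and> z \<in> B. \<psi> z)"
      by (rule sum.swap_restrict) fact+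
    also have "\<dots> = (\<Sum>z\<in>S. of_nat c * \<psi> z)"
      by (intro sum.cong refl) (simp add: c)
    finally show ?thesis by (simp add: sum_distrib_left)
  qed
  have "of_nat (card \<O>) * r = of_nat c * sum g S"
    using count[of g] \<O>(1) by simp
  moreover have "of_nat (card \<O>) * of_nat k = (of_nat c * of_nat (card S) :: complex)"
    using count[of "\<lambda>_. 1"] \<O>(1) by simp
  moreover have "card \<O> \<noteq> 0" using \<open>finite \<O>\<close> \<O>(2) by simp
  then have "of_nat (card \<O>) \<noteq> (0 :: complex)" by simp
  ultimately show ?thesis
    by (metis (no_types, lifting) mult.assoc mult.left_commute mult_cancel_left)
qed

lemma local_inverse_branch:
  assumes f: "f holomorphic_on - {0}" and w: "w \<noteq> 0" "deriv f w \<noteq> 0"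
  shows "\<exists>\<zeta>. \<zeta> analytic_on {f w} \<and> \<zeta> (f w) = w \<and>
      (\<forall>\<^sub>F t in nhds (f w). \<zeta> t \<noteq> 0 \<and> f (\<zeta> t) = t) \<and> (\<forall>\<^sub>F x in nhds w. \<zeta> (f x) = x)"
proof -
  have open0: "open (- {0::complex})" by auto
  obtain r where r: "r > 0" "ball w r \<subseteq> - {0}" "open (f ` ball w r)" "inj_on f (ball w r)"
    using has_complex_derivative_locally_invertible[OF f _ open0 w(2)] w(1) by auto
  obtain \<zeta> where \<zeta>: "\<zeta> holomorphic_on f ` ball w r" "\<And>x. x \<in> ball w r \<Longrightarrow> \<zeta> (f x) = x"
    using holomorphic_has_inverse[OF holomorphic_on_subset[OF f r(2)] open_ball r(4)] by metis
  have w': "w \<in> ball w r" using r(1) by simp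
  have "\<zeta> analytic_on {f w}"
    using \<zeta>(1) r(3) w' by (auto simp: analytic_at)
  moreover have "\<forall>\<^sub>F t in nhds (f w). \<zeta> t \<noteq> 0 \<and> f (\<zeta> t) = t"
    by (rule eventually_mono[OF eventually_nhds_in_open[OF r(3)]]) (use w' \<zeta>(2) r(2) in auto)
  moreover have "\<forall>\<^sub>F x in nhds w. \<zeta> (f x) = x"
    by (rule eventually_mono[OF eventually_nhds_in_open[OF open_ball w']]) (rule \<zeta>(2))
  ultimately show ?thesis using \<zeta>(2)[OF w'] by blast
qed

text \<open>
  Above a regular value the fibre is parametrised by local inverses of \<open>f\<close>. Their values are distinct
  for nearby \<open>t\<close>, and the bound on the cardinality shows that they exhaust the fibre.
\<close>

lemma local_fibre_branches:
  assumes f: "f holomorphic_on - {0}"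
    and fin: "\<And>t. finite {w. w \<noteq> 0 \<and> f w = t}"
    and le: "\<And>t. card {w. w \<noteq> 0 \<and> f w = t} \<le> card {w. w \<noteq> 0 \<and> f w = t0}"
    and simple: "\<And>w. w \<noteq> 0 \<Longrightarrow> f w = t0 \<Longrightarrow> deriv f w \<noteq> 0"
  obtains \<zeta> where "\<And>w. w \<noteq> 0 \<Longrightarrow> f w = t0 \<Longrightarrow> \<zeta> w analytic_on {t0} \<and> \<zeta> w t0 = w"
    and "\<And>w. w \<noteq> 0 \<Longrightarrow> f w = t0 \<Longrightarrow> \<forall>\<^sub>F t in nhds t0. f (\<zeta> w t) = t"
    and "\<And>w. w \<noteq> 0 \<Longrightarrow> f w = t0 \<Longrightarrow> \<forall>\<^sub>F x in nhds w. \<zeta> w (f x) = x"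
    and "\<forall>\<^sub>F t in nhds t0. bij_betw (\<lambda>w. \<zeta> w t) {w. w \<noteq> 0 \<and> f w = t0} {w. w \<noteq> 0 \<and> f w = t}"
proof -
  define S where "S t = {w. w \<noteq> 0 \<and> f w = t}" for t
  have "\<forall>w\<in>S t0. \<exists>\<zeta>. \<zeta> analytic_on {t0} \<and> \<zeta> t0 = w \<and>
      (\<forall>\<^sub>F t in nhds t0. \<zeta> t \<noteq> 0 \<and> f (\<zeta> t) = t) \<and> (\<forall>\<^sub>F x in nhds w. \<zeta> (f x) = x)"
    using local_inverse_branch[OF f] simple by (auto simp: S_def)
  then obtain \<zeta> where "\<forall>w\<in>S t0. \<zeta> w analytic_on {t0} \<and> \<zeta> w t0 = w \<and>
      (\<forall>\<^sub>F t in nhds t0. \<zeta> w t \<noteq> 0 \<and> f (\<zeta> w t) = t) \<and> (\<forall>\<^sub>F x in nhds w. \<zeta> w (f x) = x)"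
    by (rule bchoice[THEN exE])
  then have \<zeta>: "\<And>w. w \<in> S t0 \<Longrightarrow> \<zeta> w analytic_on {t0}" "\<And>w. w \<in> S t0 \<Longrightarrow> \<zeta> w t0 = w"
    "\<And>w. w \<in> S t0 \<Longrightarrow> \<forall>\<^sub>F t in nhds t0. \<zeta> w t \<noteq> 0 \<and> f (\<zeta> w t) = t"
    "\<And>w. w \<in> S t0 \<Longrightarrow> \<forall>\<^sub>F x in nhds w. \<zeta> w (f x) = x"
    by blast+
  have lim: "(\<zeta> w \<longlongrightarrow> w) (nhds t0)" if "w \<in> S t0" for w
    using analytic_at_imp_isCont[OF \<zeta>(1)[OF that]] \<zeta>(2)[OF that]
    by (simp add: isCont_def tendsto_nhds_iff)
  have finS: "finite (S t)" for t using fin by (simp add: S_def)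
  have "\<forall>\<^sub>F t in nhds t0. \<forall>w\<in>S t0. \<zeta> w t \<in> S t"
  proof (intro eventually_ball_finite finS ballI)
    fix w assume "w \<in> S t0"
    then show "\<forall>\<^sub>F t in nhds t0. \<zeta> w t \<in> S t"
      using \<zeta>(3)[of w] by (simp add: S_def)
  qed
  moreover have "\<forall>\<^sub>F t in nhds t0. \<forall>w\<in>S t0. \<forall>w'\<in>S t0. w \<noteq> w' \<longrightarrow> \<zeta> w t \<noteq> \<zeta> w' t"
  proof (intro eventually_ball_finite finS ballI)
    fix w w' assume w: "w \<in> S t0" "w' \<in> S t0"
    show "\<forall>\<^sub>F t in nhds t0. w \<noteq> w' \<longrightarrow> \<zeta> w t \<noteq> \<zeta> w' t"
    proof (cases "w = w'")
      case False
      have "((\<lambda>t. \<zeta> w t - \<zeta> w' t) \<longlongrightarrow> w - w') (nhds t0)"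
        using lim w by (intro tendsto_diff)
      then have "\<forall>\<^sub>F t in nhds t0. \<zeta> w t - \<zeta> w' t \<noteq> 0"
        by (rule tendsto_imp_eventually_ne) (use False in auto)
      then show ?thesis by (rule eventually_mono) auto
    qed auto
  qed
  ultimately have bij: "\<forall>\<^sub>F t in nhds t0. bij_betw (\<lambda>w. \<zeta> w t) (S t0) (S t)"
  proof eventually_elim
    case (elim t)
    have inj: "inj_on (\<lambda>w. \<zeta> w t) (S t0)" using elim(2) by (auto simp: inj_on_def)
    have "(\<lambda>w. \<zeta> w t) ` S t0 = S t"
      using elim(1) le[of t] card_image[OF inj] finS
      by (intro card_seteq) (auto simp: S_def)
    then show ?case using inj by (simp add: bij_betw_def)
  qed
  show ?thesis
  proof (rule that[of \<zeta>])
    show "\<forall>\<^sub>F t in nhds t0. f (\<zeta> w t) = t" if "w \<noteq> 0" "f w = t0" for w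
      using \<zeta>(3)[of w] that by (auto simp: S_def elim: eventually_mono)
  qed (use \<zeta> bij in \<open>auto simp: S_def\<close>)
qed

lemma analytic_eventually_zero_or_nonzero:
  fixes h :: "complex \<Rightarrow> complex"
  assumes "h analytic_on {a}"
  shows "(\<forall>\<^sub>F t in at a. h t = 0) \<or> (\<forall>\<^sub>F t in at a. h t \<noteq> 0)"
proof (cases "h a = 0")
  case True
  then show ?thesis
    using non_isolated_zero_imp_eventually_zero[OF assms] by (auto simp: isolated_zero_def)
next
  case False
  have "(h \<longlongrightarrow> h a) (at a)"
    using analytic_at_imp_isCont[OF assms] by (simp add: isCont_def)
  then show ?thesis using tendsto_imp_eventually_ne False by blast
qed

text \<open>
  This replaces the averaging over the monodromy group. The essential point is that \<open>R\<close> is single-valued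
  on the whole plane. Consider, for each \<open>t\<close>, the family of all \<open>k\<close>-element subsets of the fibre over which
  \<open>g\<close> sums up to \<open>R t\<close>; the last assumption makes it nonempty for some \<open>t\<close> arbitrarily close to \<open>t0\<close>. Along local
  branches of the fibre this family does not change, except at isolated \<open>t\<close> where further subsets may
  happen to belong to it. Hence the number \<open>\<nu> z\<close> of members containing the point \<open>z\<close> is
  constant in a punctured neighbourhood of every \<open>z\<close> outside the critical fibres. The punctured plane
  without finitely many points is connected, so this constant is the same everywhere, and the double
  counting above applies.
\<close>

lemma partial_fibre_sum_eq_average:
  fixes f g R :: "complex \<Rightarrow> complex" and T :: "complex set" and k N :: nat
  assumes f: "f holomorphic_on - {0}" and g: "g holomorphic_on - {0}" and R: "R holomorphic_on UNIV"
    and fin: "\<And>t. finite {w. w \<noteq> 0 \<and> f w = t}"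
    and le: "\<And>t. card {w. w \<noteq> 0 \<and> f w = t} \<le> N"
    and T: "finite T" "\<And>t. t \<notin> T \<Longrightarrow> card {w. w \<noteq> 0 \<and> f w = t} = N"
      "\<And>w. w \<noteq> 0 \<Longrightarrow> f w \<notin> T \<Longrightarrow> deriv f w \<noteq> 0"
    and t0: "t0 \<notin> T"
    and part: "\<exists>\<^sub>F t in at t0. \<exists>B \<subseteq> {w. w \<noteq> 0 \<and> f w = t}. card B = k \<and> sum g B = R t"
  shows "\<exists>\<^sub>F t in at t0. of_nat N * R t = of_nat k * (\<Sum>w | w \<noteq> 0 \<and> f w = t. g w)"
proof -
  define S where "S t = {w. w \<noteq> 0 \<and> f w = t}" for t
  define \<O> where "\<O> t = {B. B \<subseteq> S t \<and> card B = k \<and> sum g B = R t}" for t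
  define \<nu> where "\<nu> z = card {B \<in> \<O> (f z). z \<in> B}" for z
  have finS: "finite (S t)" for t using fin by (simp add: S_def)
  \<comment> \<open>\<open>\<nu>\<close> is constant along each local branch, apart from the value at the centre \<open>a\<close>, where the family
    may be larger.\<close>
  have branches: "\<exists>\<zeta>. (\<forall>w\<in>S a. filterlim (\<zeta> w) (at w) (at a) \<and>
        (\<exists>c. \<forall>\<^sub>F t in at a. \<nu> (\<zeta> w t) = c) \<and> (\<forall>\<^sub>F x in nhds w. \<zeta> w (f x) = x) \<and> \<zeta> w a = w) \<and>
      (\<forall>\<^sub>F t in at a. (\<lambda>w. \<zeta> w t) ` S a = S t)" if a: "a \<notin> T" for a
  proof -
    obtain \<zeta> where \<zeta>: "\<And>w. w \<in> S a \<Longrightarrow> \<zeta> w analytic_on {a}" "\<And>w. w \<in> S a \<Longrightarrow> \<zeta> w a = w"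
      "\<And>w. w \<in> S a \<Longrightarrow> \<forall>\<^sub>F t in nhds a. f (\<zeta> w t) = t"
      "\<And>w. w \<in> S a \<Longrightarrow> \<forall>\<^sub>F x in nhds w. \<zeta> w (f x) = x"
      "\<forall>\<^sub>F t in nhds a. bij_betw (\<lambda>w. \<zeta> w t) (S a) (S t)"
      using local_fibre_branches[OF f fin, of a] le T(2)[OF a] T(3) a
      unfolding S_def by (smt (verit) mem_Collect_eq)
    \<comment> \<open>The subsets of the fibre over \<open>a\<close> which continue to belong to the family for \<open>t\<close> near \<open>a\<close>.\<close>
    define \<O>a where "\<O>a = {B. B \<subseteq> S a \<and> card B = k \<and> (\<forall>\<^sub>F t in at a. (\<Sum>w\<in>B. g (\<zeta> w t)) = R t)}"
    have dich: "\<forall>\<^sub>F t in at a. (\<Sum>w\<in>B. g (\<zeta> w t)) = R t \<longleftrightarrow>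
        (\<forall>\<^sub>F t in at a. (\<Sum>w\<in>B. g (\<zeta> w t)) = R t)" if "B \<subseteq> S a" for B
    proof -
      have "(\<lambda>t. g (\<zeta> w t)) analytic_on {a}" if "w \<in> S a" for w
      proof -
        have "g analytic_on {\<zeta> w a}"
          using g \<zeta>(2)[OF that] that by (auto simp: analytic_at S_def intro!: exI[of _ "- {0}"])
        then have "(g \<circ> \<zeta> w) analytic_on {a}"
          by (intro analytic_on_compose \<zeta>(1) that) auto
        then show ?thesis by (simp add: o_def)
      qed
      moreover have "R analytic_on {a}" using R by (auto simp: analytic_at)
      ultimately have "(\<lambda>t. (\<Sum>w\<in>B. g (\<zeta> w t)) - R t) analytic_on {a}"
        using that by (intro analytic_intros) auto
      from analytic_eventually_zero_or_nonzero[OF this] show ?thesis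
      proof
        assume "\<forall>\<^sub>F t in at a. (\<Sum>w\<in>B. g (\<zeta> w t)) - R t = 0"
        then show ?thesis by simp
      next
        assume ne: "\<forall>\<^sub>F t in at a. (\<Sum>w\<in>B. g (\<zeta> w t)) - R t \<noteq> 0"
        have "\<not> (\<forall>\<^sub>F t in at a. (\<Sum>w\<in>B. g (\<zeta> w t)) = R t)"
        proof
          assume "\<forall>\<^sub>F t in at a. (\<Sum>w\<in>B. g (\<zeta> w t)) = R t"
          with ne have "\<forall>\<^sub>F t in at a. False" by eventually_elim simp
          then show False by simp
        qed
        with ne show ?thesis by simp
      qed
    qed
    have "\<forall>\<^sub>F t in at a. \<forall>B\<in>Pow (S a). (\<Sum>w\<in>B. g (\<zeta> w t)) = R t \<longleftrightarrow>
        (\<forall>\<^sub>F t in at a. (\<Sum>w\<in>B. g (\<zeta> w t)) = R t)"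
      using dich finS by (intro eventually_ball_finite) auto
    moreover have bij: "\<forall>\<^sub>F t in at a. bij_betw (\<lambda>w. \<zeta> w t) (S a) (S t)"
      using \<zeta>(5) by (rule eventually_nhds_conv_at[THEN iffD1, THEN conjunct1])
    ultimately have count: "\<forall>\<^sub>F t in at a. \<forall>w\<in>S a. \<nu> (\<zeta> w t) = card {B \<in> \<O>a. w \<in> B}"
    proof eventually_elim
      case (elim t)
      let ?\<phi> = "\<lambda>w. \<zeta> w t"
      have inj: "inj_on ?\<phi> (S a)" and im: "?\<phi> ` S a = S t" using elim(2) by (auto simp: bij_betw_def)
      have sum_im: "sum g (?\<phi> ` B) = (\<Sum>w\<in>B. g (\<zeta> w t))" if "B \<subseteq> S a" for B
        using sum.reindex[OF inj_on_subset[OF inj that]] by simp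
      have mem: "?\<phi> ` B \<in> \<O> t \<longleftrightarrow> B \<in> \<O>a" if "B \<subseteq> S a" for B
        using elim(1) that im sum_im[OF that] card_image[OF inj_on_subset[OF inj that]]
        by (auto simp: \<O>_def \<O>a_def)
      show ?case
      proof
        fix w assume w: "w \<in> S a"
        have ft: "f (\<zeta> w t) = t" using im w by (auto simp: S_def)
        have "{B \<in> \<O> t. \<zeta> w t \<in> B} = (`) ?\<phi> ` {B \<in> \<O>a. w \<in> B}"
        proof (intro equalityI subsetI)
          fix B assume "B \<in> {B \<in> \<O> t. \<zeta> w t \<in> B}"
          then have B: "B \<in> \<O> t" "\<zeta> w t \<in> B" "B \<subseteq> ?\<phi> ` S a" by (auto simp: \<O>_def im)
          then obtain B' where B': "B' \<subseteq> S a" "B = ?\<phi> ` B'" by (meson subset_imageE)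
          moreover have "w \<in> B'" using B(2) B' inj w by (auto dest: inj_onD)
          ultimately show "B \<in> (`) ?\<phi> ` {B \<in> \<O>a. w \<in> B}" using mem B(1) by auto
        next
          fix B assume "B \<in> (`) ?\<phi> ` {B \<in> \<O>a. w \<in> B}"
          then obtain B' where B': "B' \<in> \<O>a" "w \<in> B'" "B = ?\<phi> ` B'" by auto
          then have "B' \<subseteq> S a" by (simp add: \<O>a_def)
          then show "B \<in> {B \<in> \<O> t. \<zeta> w t \<in> B}" using mem B' by auto
        qed
        moreover have "inj_on ((`) ?\<phi>) {B \<in> \<O>a. w \<in> B}"
          by (rule inj_on_subset[OF inj_on_image_Pow[OF inj]]) (auto simp: \<O>a_def)
        ultimately show "\<nu> (\<zeta> w t) = card {B \<in> \<O>a. w \<in> B}"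
          by (simp add: \<nu>_def ft card_image)
      qed
    qed
    have lim: "filterlim (\<zeta> w) (at w) (at a)" if w: "w \<in> S a" for w
    proof -
      have "(\<zeta> w \<longlongrightarrow> w) (at a)"
        using analytic_at_imp_isCont[OF \<zeta>(1)[OF w]] \<zeta>(2)[OF w] by (simp add: isCont_def)
      moreover have "\<forall>\<^sub>F t in at a. \<zeta> w t \<noteq> w"
      proof -
        have "\<forall>\<^sub>F t in at a. f (\<zeta> w t) = t"
          using \<zeta>(3)[OF w] by (rule eventually_nhds_conv_at[THEN iffD1, THEN conjunct1])
        moreover have "\<forall>\<^sub>F t in at a. t \<noteq> a" by (simp add: eventually_at_filter)
        ultimately show ?thesis by eventually_elim (use w in \<open>auto simp: S_def\<close>)
      qed
      ultimately show ?thesis by (simp add: filterlim_at)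
    qed
    have "\<exists>c. \<forall>\<^sub>F t in at a. \<nu> (\<zeta> w t) = c" if "w \<in> S a" for w
      by (rule exI[of _ "card {B \<in> \<O>a. w \<in> B}"], rule eventually_mono[OF count]) (use that in auto)
    moreover have "\<forall>\<^sub>F t in at a. (\<lambda>w. \<zeta> w t) ` S a = S t"
      using bij by (rule eventually_mono) (auto simp: bij_betw_def)
    ultimately show ?thesis using lim \<zeta>(2,4) by blast
  qed
  define \<Omega> where "\<Omega> = - {0} - f -` T"
  \<comment> \<open>Transport along \<open>f\<close>: a point \<open>x\<close> near \<open>w\<close> is the value at \<open>f x\<close> of the branch through \<open>w\<close>.\<close>
  have punct: "\<exists>c. \<forall>\<^sub>F x in at w. \<nu> x = c" if "w \<in> \<Omega>" for w
  proof -
    have w: "f w \<notin> T" "w \<in> S (f w)" using that by (auto simp: \<Omega>_def S_def)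
    obtain \<zeta> c where \<zeta>: "\<forall>\<^sub>F t in at (f w). \<nu> (\<zeta> t) = c" "\<forall>\<^sub>F x in nhds w. \<zeta> (f x) = x" "\<zeta> (f w) = w"
      using branches[OF w(1)] w(2) by blast
    have ev: "\<forall>\<^sub>F x in at w. \<zeta> (f x) = x"
      using \<zeta>(2) by (rule eventually_nhds_conv_at[THEN iffD1, THEN conjunct1])
    have "isCont f w"
      using holomorphic_on_imp_continuous_on[OF f] continuous_on_eq_continuous_at[of "- {0}" f] that
      by (simp add: open_Compl \<Omega>_def)
    then have "(f \<longlongrightarrow> f w) (at w)" by (simp add: isCont_def)
    moreover have "\<forall>\<^sub>F x in at w. x \<noteq> w" by (simp add: eventually_at_filter)
    with ev have "\<forall>\<^sub>F x in at w. f x \<noteq> f w" by eventually_elim (use \<zeta>(3) in metis)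
    ultimately have "filterlim f (at (f w)) (at w)" by (simp add: filterlim_at)
    from eventually_compose_filterlim[OF \<zeta>(1) this] ev
    have "\<forall>\<^sub>F x in at w. \<nu> x = c" by eventually_elim simp
    then show ?thesis by blast
  qed
  then obtain c where c: "\<And>w. w \<in> \<Omega> \<Longrightarrow> \<forall>\<^sub>F x in at w. \<nu> x = c w" by metis
  have "finite (f -` T - {0})"
  proof -
    have "f -` T - {0} = (\<Union>t\<in>T. S t)" by (auto simp: S_def)
    then show ?thesis using T(1) finS by simp
  qed
  then have "connected (- {0} - (f -` T - {0}))"
    by (intro connected_open_delete_finite) (auto simp: connected_punctured_universe)
  moreover have "- {0} - (f -` T - {0}) = \<Omega>" by (auto simp: \<Omega>_def)
  ultimately have conn: "connected \<Omega>" by simp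
  have "c constant_on \<Omega>"
  proof (rule locally_constant_imp_constant[OF conn])
    fix w assume w: "w \<in> \<Omega>"
    obtain V where V: "open V" "w \<in> V" "\<And>x. x \<in> V \<Longrightarrow> x \<noteq> w \<Longrightarrow> \<nu> x = c w"
      using c[OF w] unfolding eventually_at_topological by auto
    have cx: "c x = c w" if x: "x \<in> V \<inter> \<Omega>" for x
    proof (cases "x = w")
      case False
      then have "\<forall>\<^sub>F y in at x. y \<in> V - {w}"
        using V(1) x by (intro eventually_at_in_open') auto
      then have "\<forall>\<^sub>F y in at x. \<nu> y = c w" by (rule eventually_mono) (use V(3) in auto)
      moreover have "\<forall>\<^sub>F y in at x. \<nu> y = c x" using c[of x] x by simp
      ultimately have "\<forall>\<^sub>F y in at x. c x = c w" by eventually_elim simp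
      then show ?thesis by simp
    qed simp
    show "\<exists>V. openin (top_of_set \<Omega>) V \<and> w \<in> V \<and> (\<forall>x\<in>V. c x = c w)"
    proof (intro exI[of _ "\<Omega> \<inter> V"] conjI ballI)
      show "openin (top_of_set \<Omega>) (\<Omega> \<inter> V)" using V(1) by (rule openin_open_Int)
      show "w \<in> \<Omega> \<inter> V" using V(2) w by blast
      show "c x = c w" if "x \<in> \<Omega> \<inter> V" for x using that by (intro cx) blast
    qed
  qed
  then obtain C where "\<forall>w\<in>\<Omega>. c w = C" unfolding constant_on_def by blast
  then have C: "\<forall>\<^sub>F x in at w. \<nu> x = C" if "w \<in> \<Omega>" for w
    using c[OF that] that by simp
  obtain \<zeta> where \<zeta>: "\<And>w. w \<in> S t0 \<Longrightarrow> filterlim (\<zeta> w) (at w) (at t0)"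
    "\<forall>\<^sub>F t in at t0. (\<lambda>w. \<zeta> w t) ` S t0 = S t"
    using branches[OF t0] by blast
  have "\<forall>\<^sub>F t in at t0. \<forall>w\<in>S t0. \<nu> (\<zeta> w t) = C"
  proof (intro eventually_ball_finite finS ballI)
    fix w assume w: "w \<in> S t0"
    then have "w \<in> \<Omega>" using t0 by (auto simp: \<Omega>_def S_def)
    from eventually_compose_filterlim[OF C[OF this] \<zeta>(1)[OF w]]
    show "\<forall>\<^sub>F t in at t0. \<nu> (\<zeta> w t) = C" .
  qed
  with \<zeta>(2) have const: "\<forall>\<^sub>F t in at t0. \<forall>z\<in>S t. \<nu> z = C"
  proof eventually_elim
    case (elim t)
    show ?case unfolding elim(1)[symmetric] using elim(2) by blast
  qed
  have "\<forall>\<^sub>F t in at t0. t \<notin> T"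
    using t0 T(1) by (intro eventually_at_in_open'[of "- T", simplified]) (auto simp: finite_imp_closed)
  with const have "\<forall>\<^sub>F t in at t0. \<O> t \<noteq> {} \<longrightarrow> of_nat N * R t = of_nat k * sum g (S t)"
  proof eventually_elim
    case (elim t)
    show ?case
    proof
      assume "\<O> t \<noteq> {}"
      moreover have "card {B \<in> \<O> t. z \<in> B} = C" if "z \<in> S t" for z
        using elim(1) that by (auto simp: \<nu>_def S_def)
      ultimately have "of_nat (card (S t)) * R t = of_nat k * sum g (S t)"
        by (intro sum_over_regular_set_family[OF finS, of "\<O> t"]) (auto simp: \<O>_def)
      then show "of_nat N * R t = of_nat k * sum g (S t)"
        using T(2)[OF elim(2)] by (simp add: S_def)
    qed
  qed
  then have "\<exists>\<^sub>F t in at t0. of_nat N * R t = of_nat k * sum g (S t)"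
    by (rule frequently_rev_mp[OF part eventually_mono]) (auto simp: \<O>_def S_def)
  then show ?thesis by (simp add: S_def)
qed

section \<open>The cycle at infinity\<close>

text \<open>
  Each solution over \<open>U\<close> is the value of a holomorphic right inverse of \<open>f\<close>, so the chain rule excludes
  critical points.
\<close>

lemma deriv_nonzero_on_branches:
  assumes B: "branches_at_infinity f n m U z" and hol: "laurent_eval f holomorphic_on - {0}"
    and t: "t \<in> U" and w: "w \<noteq> 0" "laurent_eval f w = t"
  shows "deriv (laurent_eval f) w \<noteq> 0"
proof -
  have U: "open U" and holz: "\<And>k. k \<in> {1..n+m} \<Longrightarrow> z k holomorphic_on U"
    and bij: "\<And>t. t \<in> U \<Longrightarrow> bij_betw (\<lambda>k. z k t) {1..n+m} (solutions f t)"
    using B by (auto simp: branches_at_infinity_def)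
  have "w \<in> (\<lambda>k. z k t) ` {1..n+m}"
    using bij_betw_imp_surj_on[OF bij[OF t]] w by (simp add: solutions_def)
  then obtain k where k: "k \<in> {1..n+m}" "w = z k t" by auto
  have open0: "open (- {0::complex})" by auto
  have "(z k has_field_derivative deriv (z k) t) (at t)"
    by (rule holomorphic_derivI[OF holz[OF k(1)] U t])
  moreover have "(laurent_eval f has_field_derivative deriv (laurent_eval f) (z k t)) (at (z k t))"
    by (rule holomorphic_derivI[OF hol open0]) (use k w in auto)
  ultimately have "((\<lambda>s. laurent_eval f (z k s)) has_field_derivative
      deriv (laurent_eval f) (z k t) * deriv (z k) t) (at t)"
    by (rule DERIV_chain2[rotated])
  moreover have "((\<lambda>s. laurent_eval f (z k s)) has_field_derivative 1) (at t)"
  proof (rule has_field_derivative_transform_within_open[OF DERIV_ident U t])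
    fix s assume "s \<in> U"
    then have "z k s \<in> solutions f s" using bij_betw_apply[OF bij k(1)] by simp
    then show "s = laurent_eval f (z k s)" by (simp add: solutions_def)
  qed
  ultimately have "deriv (laurent_eval f) (z k t) * deriv (z k) t = 1" by (rule DERIV_unique)
  then show ?thesis using k(2) by auto
qed

theorem proposition8p4:
  fixes f g :: "int \<Rightarrow>\<^sub>0 complex" and n m :: nat
    and U :: "complex set" and z :: "nat \<Rightarrow> complex \<Rightarrow> complex"
  assumes "n \<ge> 1" and "m \<ge> 1"
    and "Poly_Mapping.keys f \<subseteq> {- int n..int m}"
    and "Poly_Mapping.lookup f (- int n) \<noteq> 0" and "Poly_Mapping.lookup f (int m) \<noteq> 0"
    and "contour_integral (circlepath 0 1) (deriv (laurent_eval g)) = 0"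
    and "branches_at_infinity f n m U z"
  shows "(\<forall>k::nat. contour_integral (circlepath 0 1)
              (\<lambda>w. laurent_eval f w ^ k * deriv (laurent_eval g) w) = 0)
         \<longleftrightarrow> (\<forall>t\<in>U. cycle_integral (n + m) (cycle_at_infinity n m) z (laurent_eval g) t = 0)"
proof -
  let ?f = "laurent_eval f" and ?g = "laurent_eval g" and ?C = "circlepath (0::complex) 1"
  note n = assms(1) and m = assms(2) and B = assms(7)
  obtain h where deg_le: "degree h \<le> n + m"
    and coeff: "\<And>j. j \<le> n + m \<Longrightarrow> coeff h j = Poly_Mapping.lookup f (int j - int n)"
    and f: "\<And>w. w \<noteq> 0 \<Longrightarrow> ?f w = poly h w / w ^ n"
    using laurent_eval_eq_poly_divide_power[OF assms(3)] by blast
  obtain G L where g: "\<And>w. w \<noteq> 0 \<Longrightarrow> ?g w = poly G w / w ^ L"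
    using laurent_eval_eq_poly_divide_some_power by blast
  have h0: "poly h 0 \<noteq> 0" using coeff[of 0] assms(4) by (simp add: poly_0_coeff_0)
  have deg: "degree h = n + m"
    using deg_le coeff[of "n + m"] assms(5) by (intro antisym le_degree) auto
  have open0: "open (- {0::complex})" by auto
  have holf: "?f holomorphic_on - {0}" and holg: "?g holomorphic_on - {0}"
    unfolding laurent_eval_def by (auto intro!: holomorphic_intros)
  have hol_sub: "continuous_on (sphere 0 1) u" if "u holomorphic_on - {0}" for u :: "complex \<Rightarrow> complex"
    using that by (auto intro!: holomorphic_on_imp_continuous_on elim!: holomorphic_on_subset)
  have cont: "continuous_on (sphere 0 1) ?f" "continuous_on (sphere 0 1) (\<lambda>w. ?g w * deriv ?f w)"
    by (intro hol_sub holomorphic_on_mult holf holg holomorphic_deriv[OF holf open0])+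
  obtain M where M: "M \<ge> 0" "\<And>w. norm w = 1 \<Longrightarrow> norm (?f w) \<le> M"
    using continuous_on_unit_circle_bounded[OF cont(1)] by blast
  have U: "open U" "connected U" "\<not> bounded U"
    and holz: "\<And>k. k \<in> {1..n+m} \<Longrightarrow> z k holomorphic_on U"
    and bij: "\<And>t. t \<in> U \<Longrightarrow> bij_betw (\<lambda>k. z k t) {1..n+m} (solutions f t)"
    and small: "\<And>k. k \<in> {1..n} \<Longrightarrow> (z k \<longlongrightarrow> 0) (inf at_infinity (principal U))"
    and large: "\<And>k. k \<in> {n+1..n+m} \<Longrightarrow> filterlim (z k) at_infinity (inf at_infinity (principal U))"
    using B by (auto simp: branches_at_infinity_def)
  define F where "F = inf at_infinity (principal U)"
  have F: "F \<le> at_infinity" "F \<noteq> bot"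
  proof -
    show "F \<le> at_infinity" by (simp add: F_def)
    show "F \<noteq> bot"
    proof
      assume "F = bot"
      then have "\<forall>\<^sub>F t in F. False" by simp
      then obtain b where b: "\<forall>t. b \<le> norm t \<longrightarrow> t \<in> U \<longrightarrow> False"
        unfolding F_def eventually_inf_principal eventually_at_infinity by blast
      have "\<forall>t\<in>U. norm t \<le> b" using b linear by blast
      with U(3) show False by (auto simp: bounded_iff)
    qed
  qed
  have zsol: "z k t \<noteq> 0 \<and> ?f (z k t) = t" if "t \<in> U" "k \<in> {1..n+m}" for k t
    using bij_betw_apply[OF bij[OF that(1)] that(2)] by (simp add: solutions_def)
  have sol: "{w. w \<noteq> 0 \<and> ?f w = t} = (\<lambda>k. z k t) ` {1..n+m}" if "t \<in> U" for t
    using bij_betw_imp_surj_on[OF bij[OF that]] by (simp add: solutions_def)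
  have inj: "inj_on (\<lambda>k. z k t) {1..n+m}" if "t \<in> U" for t
    using bij[OF that] by (simp add: bij_betw_def)
  have crit: "deriv ?f w \<noteq> 0" if "t \<in> U" "w \<noteq> 0" "?f w = t" for t w
    by (rule deriv_nonzero_on_branches[OF B holf that])
  define S0 where "S0 t = (\<Sum>k\<in>{1..n}. ?g (z k t))" for t
  define S1 where "S1 t = (\<Sum>k\<in>{n+1..n+m}. ?g (z k t))" for t
  define cyc where "cyc = cycle_integral (n + m) (cycle_at_infinity n m) z ?g"
  have split: "{1..n+m} = {1..n} \<union> {n+1..n+m}" by auto
  have cyc: "cyc t = of_nat m * S0 t - of_nat n * S1 t" for t
  proof -
    have "cyc t = (\<Sum>k\<in>{1..n}. of_int (cycle_at_infinity n m k) * ?g (z k t)) +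
        (\<Sum>k\<in>{n+1..n+m}. of_int (cycle_at_infinity n m k) * ?g (z k t))"
      unfolding cyc_def cycle_integral_def split by (rule sum.union_disjoint) auto
    also have "\<dots> = (\<Sum>k\<in>{1..n}. of_nat m * ?g (z k t)) + (\<Sum>k\<in>{n+1..n+m}. - of_nat n * ?g (z k t))"
      by (intro arg_cong2[of _ _ _ _ "(+)"] sum.cong) (auto simp: cycle_at_infinity_def)
    finally show ?thesis by (simp add: S0_def S1_def sum_distrib_left sum_negf)
  qed
  define J where "J t = contour_integral ?C (\<lambda>w. ?g w * deriv ?f w / (?f w - t))" for t
  \<comment> \<open>For \<open>t\<close> close to infinity the unit circle separates the two groups of branches, and \<open>f\<close> does not take
    the value \<open>t\<close> on it.\<close>
  have loc: "\<forall>\<^sub>F t in F. t \<in> U \<and> norm t > M \<and> (\<forall>k\<in>{1..n}. norm (z k t) < 1) \<and>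
      (\<forall>k\<in>{n+1..n+m}. norm (z k t) > 1)"
  proof (intro eventually_conj eventually_ball_finite ballI)
    show "\<forall>\<^sub>F t in F. t \<in> U" by (simp add: F_def eventually_inf_principal)
    have "\<forall>\<^sub>F t::complex in at_infinity. norm t \<ge> M + 1" unfolding eventually_at_infinity by blast
    then have "\<forall>\<^sub>F t::complex in at_infinity. norm t > M" by (rule eventually_mono) auto
    then show "\<forall>\<^sub>F t in F. norm t > M" using F(1) by (rule filter_leD[rotated])
    show "\<forall>\<^sub>F t in F. norm (z k t) < 1" if "k \<in> {1..n}" for k
      using tendstoD[OF small[OF that], of 1] by (simp add: F_def)
    have "\<forall>\<^sub>F t::complex in at_infinity. norm t \<ge> 2" unfolding eventually_at_infinity by blast
    then have "\<forall>\<^sub>F t::complex in at_infinity. norm t > 1" by (rule eventually_mono) auto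
    then show "\<forall>\<^sub>F t in F. norm (z k t) > 1" if "k \<in> {n+1..n+m}" for k
      using large[OF that] unfolding F_def by (rule eventually_compose_filterlim)
  qed auto
  have inside: "{w \<in> (\<lambda>k. z k t) ` {1..n+m}. norm w < 1} = (\<lambda>k. z k t) ` {1..n}"
    and outside: "{w \<in> (\<lambda>k. z k t) ` {1..n+m}. norm w > 1} = (\<lambda>k. z k t) ` {n+1..n+m}"
    if "\<forall>k\<in>{1..n}. norm (z k t) < 1" "\<forall>k\<in>{n+1..n+m}. norm (z k t) > 1" for t
  proof -
    have "\<not> norm (z k t) > 1" if "k \<in> {1..n}" for k
      using \<open>\<forall>k\<in>{1..n}. norm (z k t) < 1\<close> that by (meson not_less_iff_gr_or_eq order_less_trans)
    moreover have "\<not> norm (z k t) < 1" if "k \<in> {n+1..n+m}" for k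
      using \<open>\<forall>k\<in>{n+1..n+m}. norm (z k t) > 1\<close> that by (meson not_less_iff_gr_or_eq order_less_trans)
    ultimately show "{w \<in> (\<lambda>k. z k t) ` {1..n+m}. norm w < 1} = (\<lambda>k. z k t) ` {1..n}"
      "{w \<in> (\<lambda>k. z k t) ` {1..n+m}. norm w > 1} = (\<lambda>k. z k t) ` {n+1..n+m}"
      using that unfolding split by blast+
  qed
  obtain p0 where p0: "\<And>t. (\<forall>w. norm w = 1 \<longrightarrow> ?f w \<noteq> t) \<Longrightarrow>
      (\<forall>w. w \<noteq> 0 \<and> norm w < 1 \<and> ?f w = t \<longrightarrow> deriv ?f w \<noteq> 0) \<Longrightarrow>
      J t = 2 * of_real pi * \<i> * (\<Sum>w\<in>{w. w \<noteq> 0 \<and> norm w < 1 \<and> ?f w = t}. ?g w) + poly p0 t"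
    using circle_integral_eq_small_fibre_sum[OF f g n h0] unfolding J_def by blast
  have sum0: "\<forall>\<^sub>F t in F. J t = 2 * of_real pi * \<i> * S0 t + poly p0 t"
    using loc
  proof eventually_elim
    case (elim t)
    then have t: "t \<in> U" by simp
    have "{w. w \<noteq> 0 \<and> norm w < 1 \<and> ?f w = t} = {w \<in> (\<lambda>k. z k t) ` {1..n+m}. norm w < 1}"
      using sol[OF t] by auto
    also have "\<dots> = (\<lambda>k. z k t) ` {1..n}"
      by (rule inside) (use elim in auto)
    finally have eq: "{w. w \<noteq> 0 \<and> norm w < 1 \<and> ?f w = t} = (\<lambda>k. z k t) ` {1..n}" .
    have "inj_on (\<lambda>k. z k t) {1..n}" by (rule inj_on_subset[OF inj[OF t]]) auto
    then have "(\<Sum>w\<in>{w. w \<noteq> 0 \<and> norm w < 1 \<and> ?f w = t}. ?g w) = S0 t"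
      unfolding eq S0_def by (simp add: sum.reindex)
    moreover have "\<forall>w. norm w = 1 \<longrightarrow> ?f w \<noteq> t" using M(2) elim by fastforce
    ultimately show ?case using p0[of t] crit[OF t] by auto
  qed
  \<comment> \<open>The solutions close to infinity are the inverses of the small solutions for \<open>f(1 / w)\<close>.\<close>
  define f' where "f' w = ?f (inverse w)" for w
  define g' where "g' w = ?g (inverse w)" for w
  have f': "f' w = poly (reflect_poly h) w / w ^ m" if "w \<noteq> 0" for w
    using that f[of "inverse w"] poly_divide_power_inverse[OF deg that] by (simp add: f'_def)
  have g': "g' w = poly (monom 1 L * reflect_poly G) w / w ^ degree G" if "w \<noteq> 0" for w
    using that g[of "inverse w"] by (simp add: g'_def poly_reflect_poly_nz poly_monom field_simps)
  have df': "deriv f' w = - deriv ?f (inverse w) / w ^ 2" if "w \<noteq> 0" for w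
  proof -
    have "(?f has_field_derivative deriv ?f (inverse w)) (at (inverse w))"
      by (rule holomorphic_derivI[OF holf open0]) (use that in auto)
    from DERIV_chain2[OF this DERIV_inverse[OF that]] show ?thesis
      unfolding f'_def by (simp add: DERIV_imp_deriv power2_eq_square divide_inverse)
  qed
  have J': "contour_integral ?C (\<lambda>w. g' w * deriv f' w / (f' w - t)) = - J t" for t
  proof -
    let ?u = "\<lambda>w. - (?g w * deriv ?f w / (?f w - t))"
    have "contour_integral ?C (\<lambda>w. g' w * deriv f' w / (f' w - t)) =
        contour_integral ?C (\<lambda>w. ?u (inverse w) / w ^ 2)"
    proof (rule contour_integral_cong)
      fix w assume "w \<in> path_image ?C"
      then have "w \<noteq> 0" by auto
      then show "g' w * deriv f' w / (f' w - t) = ?u (inverse w) / w ^ 2"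
        by (simp add: df' f'_def g'_def)
    qed simp
    also have "\<dots> = contour_integral ?C ?u" by (rule contour_integral_unit_circle_inverse)
    also have "\<dots> = - J t" unfolding J_def by (rule contour_integral_neg)
    finally show ?thesis .
  qed
  have h0': "poly (reflect_poly h) 0 \<noteq> 0" using h0 by auto
  obtain p1 where p1: "\<And>t. (\<forall>w. norm w = 1 \<longrightarrow> f' w \<noteq> t) \<Longrightarrow>
      (\<forall>w. w \<noteq> 0 \<and> norm w < 1 \<and> f' w = t \<longrightarrow> deriv f' w \<noteq> 0) \<Longrightarrow>
      - J t = 2 * of_real pi * \<i> * (\<Sum>w\<in>{w. w \<noteq> 0 \<and> norm w < 1 \<and> f' w = t}. g' w) + poly p1 t"
    using circle_integral_eq_small_fibre_sum[OF f' g' m h0'] unfolding J' by blast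
  have sum1: "\<forall>\<^sub>F t in F. - J t = 2 * of_real pi * \<i> * S1 t + poly p1 t"
    using loc
  proof eventually_elim
    case (elim t)
    then have t: "t \<in> U" by simp
    have "{w. w \<noteq> 0 \<and> norm w < 1 \<and> f' w = t} = inverse ` {w. w \<noteq> 0 \<and> norm w > 1 \<and> ?f w = t}"
    proof (intro equalityI subsetI)
      fix w assume w: "w \<in> {w. w \<noteq> 0 \<and> norm w < 1 \<and> f' w = t}"
      then have "inverse w \<in> {w. w \<noteq> 0 \<and> norm w > 1 \<and> ?f w = t}"
        by (simp add: f'_def norm_inverse one_less_inverse)
      then show "w \<in> inverse ` {w. w \<noteq> 0 \<and> norm w > 1 \<and> ?f w = t}"
        by (rule rev_image_eqI) simp
    next
      fix w assume "w \<in> inverse ` {w. w \<noteq> 0 \<and> norm w > 1 \<and> ?f w = t}"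
      then show "w \<in> {w. w \<noteq> 0 \<and> norm w < 1 \<and> f' w = t}"
        by (auto simp: f'_def norm_inverse inverse_less_1_iff)
    qed
    also have "{w. w \<noteq> 0 \<and> norm w > 1 \<and> ?f w = t} = {w \<in> (\<lambda>k. z k t) ` {1..n+m}. norm w > 1}"
      using sol[OF t] by auto
    also have "\<dots> = (\<lambda>k. z k t) ` {n+1..n+m}"
      by (rule outside) (use elim in auto)
    finally have eq: "{w. w \<noteq> 0 \<and> norm w < 1 \<and> f' w = t} = inverse ` (\<lambda>k. z k t) ` {n+1..n+m}" .
    have "inj_on (\<lambda>k. z k t) {n+1..n+m}" by (rule inj_on_subset[OF inj[OF t]]) auto
    then have "(\<Sum>w\<in>{w. w \<noteq> 0 \<and> norm w < 1 \<and> f' w = t}. g' w) = S1 t"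
      unfolding eq S1_def by (simp add: sum.reindex inj_on_def g'_def)
    moreover have "\<forall>w. norm w = 1 \<longrightarrow> f' w \<noteq> t"
    proof (intro allI impI)
      fix w :: complex assume "norm w = 1"
      then show "f' w \<noteq> t" using M(2)[of "inverse w"] elim by (auto simp: f'_def norm_inverse)
    qed
    moreover have "\<forall>w. w \<noteq> 0 \<and> norm w < 1 \<and> f' w = t \<longrightarrow> deriv f' w \<noteq> 0"
      using crit[OF t] by (auto simp: df' f'_def)
    ultimately show ?case using p1[of t] by simp
  qed
  note parts = circle_integral_by_parts[OF holf holg]
  show ?thesis unfolding cyc_def[symmetric]
  proof
    assume I: "\<forall>k. contour_integral ?C (\<lambda>w. ?f w ^ k * deriv ?g w) = 0"
    have mz: "contour_integral ?C (\<lambda>w. ?g w * deriv ?f w * ?f w ^ k) = 0" for k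
      using parts[of k] I[rule_format, of "Suc k"] by (simp del: of_nat_Suc power_Suc)
    \<comment> \<open>Since \<open>J\<close> vanishes near infinity, \<open>S0\<close> agrees there with a polynomial, which is defined on the whole
      plane.\<close>
    define R where "R t = - poly p0 t / (2 * of_real pi * \<i>)" for t
    have "\<forall>\<^sub>F t in F. S0 t = R t \<and> t \<in> U"
      using sum0 loc
    proof eventually_elim
      case (elim t)
      have "J t = 0" unfolding J_def
        by (rule circle_moments_zero_imp_resolvent_zero[OF cont(2,1) M(2) _ mz]) (use elim in auto)
      then show ?case using elim by (simp add: R_def field_simps add_eq_0_iff)
    qed
    then obtain b where b: "\<And>t. t \<in> U \<Longrightarrow> norm t \<ge> b \<Longrightarrow> S0 t = R t"
      unfolding F_def eventually_inf_principal eventually_at_infinity by blast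
    define V where "V = U \<inter> - cball 0 b"
    have "open V" using U(1) by (simp add: V_def open_Int open_Compl)
    have "V \<noteq> {}"
    proof
      assume "V = {}"
      then have "U \<subseteq> cball 0 b" by (auto simp: V_def)
      with U(3) show False using bounded_subset bounded_cball by blast
    qed
    then obtain t0 where t0: "t0 \<in> V" by blast
    then have t0U: "t0 \<in> U" by (simp add: V_def)
    have evV: "\<forall>\<^sub>F t in at t0. t \<in> V" using \<open>open V\<close> t0 by (rule eventually_at_in_open')
    define T where "T = ?f ` {w. w \<noteq> 0 \<and> deriv ?f w = 0}"
    have simple: "deriv ?f w \<noteq> 0" if "w \<noteq> 0" "?f w \<notin> T" for w using that by (auto simp: T_def)
    have "\<exists>\<^sub>F t in at t0. of_nat (n + m) * R t = of_nat n * (\<Sum>w | w \<noteq> 0 \<and> ?f w = t. ?g w)"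
    proof (rule partial_fibre_sum_eq_average[OF holf holg])
      show "R holomorphic_on UNIV" unfolding R_def by (intro holomorphic_intros) auto
      show "finite {w. w \<noteq> 0 \<and> ?f w = t}" "card {w. w \<noteq> 0 \<and> ?f w = t} \<le> n + m" for t
        by (rule fibre_finite_card(1)[OF f deg n m h0], assumption)
          (rule fibre_finite_card(2)[OF f deg n m h0], assumption)
      show "finite T" unfolding T_def by (intro finite_imageI finite_critical_points[OF f n h0])
      show "card {w. w \<noteq> 0 \<and> ?f w = t} = n + m" if "t \<notin> T" for t
        by (rule fibre_finite_card(3)[OF f deg n m h0]) (use simple that in auto)
      show "deriv ?f w \<noteq> 0" if "w \<noteq> 0" "?f w \<notin> T" for w by (rule simple[OF that])
      show "t0 \<notin> T" using crit[OF t0U] by (auto simp: T_def)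
      have "\<forall>\<^sub>F t in at t0. \<exists>B\<subseteq>{w. w \<noteq> 0 \<and> ?f w = t}. card B = n \<and> sum ?g B = R t"
        using evV
      proof eventually_elim
        case (elim t)
        then have t: "t \<in> U" "norm t \<ge> b" by (auto simp: V_def)
        have "inj_on (\<lambda>k. z k t) {1..n}" by (rule inj_on_subset[OF inj[OF t(1)]]) auto
        then have "card ((\<lambda>k. z k t) ` {1..n}) = n" "sum ?g ((\<lambda>k. z k t) ` {1..n}) = R t"
          using b[OF t] by (simp_all add: card_image sum.reindex S0_def)
        moreover have "(\<lambda>k. z k t) ` {1..n} \<subseteq> {w. w \<noteq> 0 \<and> ?f w = t}"
          unfolding sol[OF t(1)] by auto
        ultimately show ?case by blast
      qed
      then show "\<exists>\<^sub>F t in at t0. \<exists>B\<subseteq>{w. w \<noteq> 0 \<and> ?f w = t}. card B = n \<and> sum ?g B = R t"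
        by (rule eventually_frequently[rotated]) simp
    qed
    then have "\<exists>\<^sub>F t in at t0. t \<in> {t \<in> U. cyc t = 0}"
    proof (rule frequently_rev_mp)
      show "\<forall>\<^sub>F t in at t0. of_nat (n + m) * R t = of_nat n * (\<Sum>w | w \<noteq> 0 \<and> ?f w = t. ?g w) \<longrightarrow>
          t \<in> {t \<in> U. cyc t = 0}"
        using evV
      proof eventually_elim
        case (elim t)
        then have t: "t \<in> U" "norm t \<ge> b" by (auto simp: V_def)
        have "(\<Sum>w | w \<noteq> 0 \<and> ?f w = t. ?g w) = (\<Sum>k\<in>{1..n+m}. ?g (z k t))"
          unfolding sol[OF t(1)] sum.reindex[OF inj[OF t(1)]] by (simp only: o_def)
        also have "\<dots> = S0 t + S1 t"
          unfolding split S0_def S1_def by (rule sum.union_disjoint) auto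
        finally show ?case using b[OF t] t(1) by (auto simp: cyc algebra_simps)
      qed
    qed
    then have lim: "t0 islimpt {t \<in> U. cyc t = 0}" by (simp add: islimpt_conv_frequently_at)
    have holcyc: "cyc holomorphic_on U"
    proof -
      have "(\<lambda>t. ?g (z k t)) holomorphic_on U" if "k \<in> {1..n+m}" for k
      proof -
        have "z k ` U \<subseteq> - {0}"
          by (rule image_subsetI) (use zsol[OF _ that] in simp)
        from holomorphic_on_compose_gen[OF holz[OF that] holg this] show ?thesis by (simp add: o_def)
      qed
      then show ?thesis
        unfolding cyc_def cycle_integral_def by (intro holomorphic_intros)
    qed
    show "\<forall>t\<in>U. cyc t = 0"
      using analytic_continuation[OF holcyc U(1,2) _ t0U lim] by blast
  next
    assume Z: "\<forall>t\<in>U. cyc t = 0"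
    \<comment> \<open>Solving \<open>m (J - p0) = n (- J - p1)\<close> for \<open>J\<close>.\<close>
    define q where "q = smult (1 / of_nat (n + m)) (smult (of_nat m) p0 - smult (of_nat n) p1)"
    have nm: "(of_nat (n + m) :: complex) \<noteq> 0" using n by (simp del: of_nat_add)
    have "\<forall>\<^sub>F t in F. J t = poly q t"
      using sum0 sum1 loc
    proof eventually_elim
      case (elim t)
      then have "of_nat m * S0 t = of_nat n * S1 t" using Z by (simp add: cyc)
      then have "of_nat m * (2 * of_real pi * \<i> * S0 t) = of_nat n * (2 * of_real pi * \<i> * S1 t)"
        by (simp add: mult.left_commute)
      moreover have "2 * of_real pi * \<i> * S0 t = J t - poly p0 t" "2 * of_real pi * \<i> * S1 t = - J t - poly p1 t"
        using elim by (simp_all add: algebra_simps)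
      ultimately have "of_nat m * (J t - poly p0 t) = of_nat n * (- J t - poly p1 t)" by simp
      then have "of_nat (n + m) * J t = of_nat m * poly p0 t - of_nat n * poly p1 t"
        by (simp add: algebra_simps)
      then show ?case using nm by (simp add: q_def field_simps del: of_nat_add)
    qed
    then have mz: "contour_integral ?C (\<lambda>w. ?g w * deriv ?f w * ?f w ^ k) = 0" for k
      unfolding J_def by (rule polynomial_resolvent_imp_circle_moments_zero[OF cont(2,1) F])
    show "\<forall>k. contour_integral ?C (\<lambda>w. ?f w ^ k * deriv ?g w) = 0"
    proof
      fix k show "contour_integral ?C (\<lambda>w. ?f w ^ k * deriv ?g w) = 0"
      proof (cases k)
        case 0
        then show ?thesis using assms(6) by simp
      next
        case (Suc j)
        show ?thesis using parts[of j] mz[of j] unfolding Suc by (simp del: of_nat_Suc power_Suc)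
      qed
    qed
  qed
qed

end
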